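(* Let $E$ be a quasi-Banach ideal space with the Fatou property over $(T,\Sigma,\mu)$ and let $\varphi$ be an Orlicz function with $a_\varphi<b_\varphi$ and $\alpha^E_\varphi>0$. Suppose one of the following three conditions holds: (i) neither $L_\infty\subset E$ nor $E\subset L_\infty$, and $\varphi\in\Delta_{2-str}(\mathbb R_+)$; (ii) $L_\infty\subset E$, and either $\varphi\in\Delta_{2-str}(\mathbb R_+)$, or [$E$ is a Banach ideal space, $\varphi\in\Delta_{2-str}(\infty)$ and $\varphi$ is strictly increasing on the interval $(a_\varphi,\infty)$]; (iii) $E\subset L_\infty$, $\varphi\in\Delta_{2-str}(0)$, $1/a_E\le\varphi(b_\varphi)$ and $\varphi$ is strictly increasing on the interval $(0,\varphi^{-1}(1/a_E))$. If $E_\varphi$ contains an order linearly isometric copy of $l_\infty$, then $E$ also contains such a copy.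
   Context: $(T,\Sigma,\mu)$ is a complete $\sigma$-finite measure space with $\mu(T)>0$; $L^0$ is the space of ($\mu$-a.e. classes of) real $\Sigma$-measurable functions on $T$, with the a.e. order; $L_\infty=L_\infty(T,\Sigma,\mu)$. A quasi-norm is a functional satisfying the axioms of a norm with the triangle inequality replaced by $\|x+y\|\le C(\|x\|+\|y\|)$ for some constant $C\ge1$. A quasi-Banach ideal space is a linear subspace $E\subset L^0$ with a complete quasi-norm $\|\cdot\|_E$ such that (i) $x\in L^0$, $y\in E$, $|x|\le|y|$ a.e. imply $x\in E$, $\|x\|_E\le\|y\|_E$; (ii) some $x\in E$ is strictly positive on $T$. It is a Banach ideal space if $\|\cdot\|_E$ is a norm. $E$ has the Fatou property if $0\le x_n\uparrow|x|$ a.e., $x_n\in E$, $x\in L^0$, $\sup_n\|x_n\|_E<\infty$ imply $x\in E$ and $\|x_n\|_E\to\|x\|_E$. An Orlicz function is a non-decreasing $\varphi:[0,\infty)\to[0,\infty]$ with $\varphi(0)=0$, right continuous at $0$, continuous on $(0,b_\varphi)$ and left continuous at $b_\varphi$, where $b_\varphi=\sup\{u\ge0:\varphi(u)<\infty\}$, and with $\lim_{u\to\infty}\varphi(u)=\infty$ (so $\varphi(b_\varphi)$ means $\infty$ if $b_\varphi=\infty$). $a_\varphi=\sup\{u\ge0:\varphi(u)=0\}$; $\varphi^{-1}(v)=\inf\{u\ge0:\varphi(u)>v\}$ for $v\in[0,\infty)$. For $E\subset L_\infty$, $a_E=\inf\{\|\chi_A\|_E:\chi_A\in E,\ \mu(A)>0\}$,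 which is positive. $\varphi\in\Delta_{2-str}(\mathbb R_+)$: for any $\varepsilon>0$ there is $\delta=\delta(\varepsilon)>0$ with $\varphi((1+\delta)u)\le(1+\varepsilon)\varphi(u)$ for all $u\ge0$. $\varphi\in\Delta_{2-str}(\infty)$ [$\Delta_{2-str}(0)$]: for any $\varepsilon>0$ there are $\delta>0$ and $u_0>0$ (depending on $\varepsilon$) with $\varphi(u_0)<\infty$ [$\varphi(u_0)>0$] such that this inequality holds for all $u\ge u_0$ [$0\le u\le u_0$]. Indices: $\alpha^a_\varphi$ is the supremum of $p\in\mathbb R$ for which there is $K\ge1$ with $\varphi(au)\le Ka^p\varphi(u)$ for all $u\ge0$, $0<a\le1$; $\alpha^\infty_\varphi$ is the same with the inequality required only for $u\ge u_0$, for some $u_0>0$ with $\varphi(u_0)<\infty$; $\alpha^0_\varphi$ is the same with the inequality required only for $0\le u\le u_0$, for some $u_0>0$. $\alpha^E_\varphi=\alpha^a_\varphi$ if neither $L_\infty\subset E$ nor $E\subset L_\infty$; $\alpha^E_\varphi=\alpha^\infty_\varphi$ if $L_\infty\subset E$; $\alpha^E_\varphi=\alpha^0_\varphi$ if $E\subset L_\infty$ (if $E=L_\infty$ as sets, either of the last two). $\rho^E_\varphi(x)=\|\varphi(|x|)\|_E$ if $\varphi(|x|)\in E$, and $=\infty$ otherwise; $E_\varphi=\{x\in L^0:\rho^E_\varphi(\lambda x)<\infty\text{ for some }\lambda>0\}$ with the quasi-norm $\|x\|_\varphi=\inf\{\lambda>0:\rho^E_\varphi(x/\lambda)\le1\}$.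 A quasi-normed ideal space $F$ contains an order linearly isometric copy of $l_\infty$ if there is a linear map $P:l_\infty\to F$ with $\|Pz\|_F=\|z\|_{l_\infty}$ and $|Pz|=P|z|$ for all $z\in l_\infty$. *)

theory Defs
  imports "HOL-Analysis.Analysis"
begin

text \<open>
  The elements of \<open>L\<^sup>0\<close> are represented by real Borel measurable functions on \<open>M\<close>; two functions
  stand for the same class iff they agree almost everywhere. A space of classes is a set \<open>E\<close> of
  such functions together with a functional \<open>N\<close> that only matters on \<open>E\<close>; condition (i) of an
  ideal space makes \<open>E\<close> and \<open>N\<close> invariant under almost everywhere equality.
\<close>

definition quasi_normed_space ::
  "'a measure \<Rightarrow> ('a \<Rightarrow> real) set \<Rightarrow> (('a \<Rightarrow> real) \<Rightarrow> real) \<Rightarrow> real \<Rightarrow> bool" where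
  "quasi_normed_space M E N C \<longleftrightarrow>
     E \<subseteq> borel_measurable M \<and>
     (\<lambda>t. 0) \<in> E \<and>
     (\<forall>x\<in>E. \<forall>y\<in>E. (\<lambda>t. x t + y t) \<in> E) \<and>
     (\<forall>x\<in>E. \<forall>c. (\<lambda>t. c * x t) \<in> E) \<and>
     (\<forall>x\<in>E. 0 \<le> N x) \<and>
     (\<forall>x\<in>E. N x = 0 \<longleftrightarrow> (AE t in M. x t = 0)) \<and>
     (\<forall>x\<in>E. \<forall>c. N (\<lambda>t. c * x t) = \<bar>c\<bar> * N x) \<and>
     (\<forall>x\<in>E. \<forall>y\<in>E. N (\<lambda>t. x t + y t) \<le> C * (N x + N y))"

definition complete_quasi_norm ::
  "('a \<Rightarrow> real) set \<Rightarrow> (('a \<Rightarrow> real) \<Rightarrow> real) \<Rightarrow> bool" where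
  "complete_quasi_norm E N \<longleftrightarrow>
     (\<forall>x :: nat \<Rightarrow> 'a \<Rightarrow> real.
        (\<forall>n. x n \<in> E) \<and>
        (\<forall>e>0. \<exists>k. \<forall>m\<ge>k. \<forall>n\<ge>k. N (\<lambda>t. x m t - x n t) < e) \<longrightarrow>
        (\<exists>y\<in>E. (\<lambda>n. N (\<lambda>t. x n t - y t)) \<longlonglongrightarrow> 0))"

definition ideal_property ::
  "'a measure \<Rightarrow> ('a \<Rightarrow> real) set \<Rightarrow> (('a \<Rightarrow> real) \<Rightarrow> real) \<Rightarrow> bool" where
  "ideal_property M E N \<longleftrightarrow>
     (\<forall>x\<in>borel_measurable M. \<forall>y\<in>E.
        (AE t in M. \<bar>x t\<bar> \<le> \<bar>y t\<bar>) \<longrightarrow> x \<in> E \<and> N x \<le> N y)"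

definition quasi_Banach_ideal_space ::
  "'a measure \<Rightarrow> ('a \<Rightarrow> real) set \<Rightarrow> (('a \<Rightarrow> real) \<Rightarrow> real) \<Rightarrow> bool" where
  "quasi_Banach_ideal_space M E N \<longleftrightarrow>
     (\<exists>C\<ge>1. quasi_normed_space M E N C) \<and>
     complete_quasi_norm E N \<and>
     ideal_property M E N \<and>
     (\<exists>x\<in>E. AE t in M. 0 < x t)"

definition Banach_ideal_space ::
  "'a measure \<Rightarrow> ('a \<Rightarrow> real) set \<Rightarrow> (('a \<Rightarrow> real) \<Rightarrow> real) \<Rightarrow> bool" where
  "Banach_ideal_space M E N \<longleftrightarrow>
     quasi_Banach_ideal_space M E N \<and>
     (\<forall>x\<in>E. \<forall>y\<in>E. N (\<lambda>t. x t + y t) \<le> N x + N y)"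

definition Fatou_property ::
  "'a measure \<Rightarrow> ('a \<Rightarrow> real) set \<Rightarrow> (('a \<Rightarrow> real) \<Rightarrow> real) \<Rightarrow> bool" where
  "Fatou_property M E N \<longleftrightarrow>
     (\<forall>(x :: nat \<Rightarrow> 'a \<Rightarrow> real) y.
        (\<forall>n. x n \<in> E) \<and> y \<in> borel_measurable M \<and>
        (AE t in M. (\<forall>n. 0 \<le> x n t) \<and> incseq (\<lambda>n. x n t) \<and> (\<lambda>n. x n t) \<longlonglongrightarrow> \<bar>y t\<bar>) \<and>
        bdd_above (range (\<lambda>n. N (x n))) \<longrightarrow>
        y \<in> E \<and> (\<lambda>n. N (x n)) \<longlonglongrightarrow> N y)"

definition Linfty :: "'a measure \<Rightarrow> ('a \<Rightarrow> real) set" where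
  "Linfty M = {x \<in> borel_measurable M. \<exists>c. AE t in M. \<bar>x t\<bar> \<le> c}"

text \<open>The infimum \<open>a\<^sub>E\<close>; the set is nonempty whenever \<open>E\<close> is an ideal space over a nonzero measure.\<close>

definition ideal_lower_const ::
  "'a measure \<Rightarrow> ('a \<Rightarrow> real) set \<Rightarrow> (('a \<Rightarrow> real) \<Rightarrow> real) \<Rightarrow> real" where
  "ideal_lower_const M E N =
     Inf {N (indicator A) | A. A \<in> sets M \<and> indicator A \<in> E \<and> 0 < emeasure M A}"


text \<open>
  An Orlicz function is a function \<open>\<phi> :: real \<Rightarrow> ennreal\<close> of which only the restriction to \<open>[0,\<infinity>)\<close>
  is used.
\<close>

definition orlicz_a :: "(real \<Rightarrow> ennreal) \<Rightarrow> ereal" where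
  "orlicz_a \<phi> = Sup {ereal u | u. 0 \<le> u \<and> \<phi> u = 0}"

definition orlicz_b :: "(real \<Rightarrow> ennreal) \<Rightarrow> ereal" where
  "orlicz_b \<phi> = Sup {ereal u | u. 0 \<le> u \<and> \<phi> u < \<infinity>}"

definition orlicz_at_b :: "(real \<Rightarrow> ennreal) \<Rightarrow> ennreal" where
  "orlicz_at_b \<phi> = (if orlicz_b \<phi> = \<infinity> then \<infinity> else \<phi> (real_of_ereal (orlicz_b \<phi>)))"

definition orlicz_function :: "(real \<Rightarrow> ennreal) \<Rightarrow> bool" where
  "orlicz_function \<phi> \<longleftrightarrow>
     mono_on {0..} \<phi> \<and>
     \<phi> 0 = 0 \<and>
     continuous (at_right 0) \<phi> \<and>
     continuous_on {u. 0 < u \<and> ereal u < orlicz_b \<phi>} \<phi> \<and>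
     (\<forall>b. orlicz_b \<phi> = ereal b \<longrightarrow> continuous (at_left b) \<phi>) \<and>
     (\<phi> \<longlongrightarrow> \<infinity>) at_top"

definition orlicz_inverse :: "(real \<Rightarrow> ennreal) \<Rightarrow> real \<Rightarrow> real" where
  "orlicz_inverse \<phi> v = Inf {u. 0 \<le> u \<and> \<phi> u > ennreal v}"

definition Delta2_str :: "(real \<Rightarrow> ennreal) \<Rightarrow> bool" where
  "Delta2_str \<phi> \<longleftrightarrow>
     (\<forall>\<epsilon>>0. \<exists>\<delta>>0. \<forall>u\<ge>0. \<phi> ((1 + \<delta>) * u) \<le> ennreal (1 + \<epsilon>) * \<phi> u)"

definition Delta2_str_infinity :: "(real \<Rightarrow> ennreal) \<Rightarrow> bool" where
  "Delta2_str_infinity \<phi> \<longleftrightarrow>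
     (\<forall>\<epsilon>>0. \<exists>\<delta>>0. \<exists>u0>0. \<phi> u0 < \<infinity> \<and>
        (\<forall>u\<ge>u0. \<phi> ((1 + \<delta>) * u) \<le> ennreal (1 + \<epsilon>) * \<phi> u))"

definition Delta2_str_zero :: "(real \<Rightarrow> ennreal) \<Rightarrow> bool" where
  "Delta2_str_zero \<phi> \<longleftrightarrow>
     (\<forall>\<epsilon>>0. \<exists>\<delta>>0. \<exists>u0>0. \<phi> u0 > 0 \<and>
        (\<forall>u. 0 \<le> u \<and> u \<le> u0 \<longrightarrow> \<phi> ((1 + \<delta>) * u) \<le> ennreal (1 + \<epsilon>) * \<phi> u))"

definition index_all :: "(real \<Rightarrow> ennreal) \<Rightarrow> ereal" where
  "index_all \<phi> = Sup {ereal p | p. \<exists>K\<ge>1. \<forall>u\<ge>0. \<forall>a. 0 < a \<and> a \<le> 1 \<longrightarrow>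
     \<phi> (a * u) \<le> ennreal (K * a powr p) * \<phi> u}"

definition index_infinity :: "(real \<Rightarrow> ennreal) \<Rightarrow> ereal" where
  "index_infinity \<phi> = Sup {ereal p | p. \<exists>K\<ge>1. \<exists>u0>0. \<phi> u0 < \<infinity> \<and>
     (\<forall>u\<ge>u0. \<forall>a. 0 < a \<and> a \<le> 1 \<longrightarrow> \<phi> (a * u) \<le> ennreal (K * a powr p) * \<phi> u)}"

definition index_zero :: "(real \<Rightarrow> ennreal) \<Rightarrow> ereal" where
  "index_zero \<phi> = Sup {ereal p | p. \<exists>K\<ge>1. \<exists>u0>0.
     (\<forall>u a. 0 \<le> u \<and> u \<le> u0 \<and> 0 < a \<and> a \<le> 1 \<longrightarrow>
        \<phi> (a * u) \<le> ennreal (K * a powr p) * \<phi> u)}"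

text \<open>
  \<open>is_index M E \<phi> \<alpha>\<close> says that \<open>\<alpha>\<close> is an admissible value of the index \<open>\<alpha>\<^sup>E\<close> of \<open>\<phi>\<close>. The value is
  unique unless \<open>E\<close> and \<open>L\<^sub>\<infinity>\<close> coincide as sets, when either of the last two may be taken.
\<close>

definition is_index ::
  "'a measure \<Rightarrow> ('a \<Rightarrow> real) set \<Rightarrow> (real \<Rightarrow> ennreal) \<Rightarrow> ereal \<Rightarrow> bool" where
  "is_index M E \<phi> \<alpha> \<longleftrightarrow>
     (\<not> Linfty M \<subseteq> E \<and> \<not> E \<subseteq> Linfty M \<and> \<alpha> = index_all \<phi>) \<or>
     (Linfty M \<subseteq> E \<and> \<alpha> = index_infinity \<phi>) \<or>
     (E \<subseteq> Linfty M \<and> \<alpha> = index_zero \<phi>)"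

text \<open>
  As \<open>\<phi>\<close> may take the value \<open>\<infinity>\<close>, the composition \<open>\<phi>(\<bar>x\<bar>)\<close> belongs to \<open>E\<close> iff it is finite almost
  everywhere and its real-valued representative lies in \<open>E\<close>.
\<close>

definition orlicz_modular ::
  "'a measure \<Rightarrow> ('a \<Rightarrow> real) set \<Rightarrow> (('a \<Rightarrow> real) \<Rightarrow> real) \<Rightarrow> (real \<Rightarrow> ennreal) \<Rightarrow>
   ('a \<Rightarrow> real) \<Rightarrow> ennreal" where
  "orlicz_modular M E N \<phi> x =
     (if (AE t in M. \<phi> \<bar>x t\<bar> < \<infinity>) \<and> (\<lambda>t. enn2real (\<phi> \<bar>x t\<bar>)) \<in> E
      then ennreal (N (\<lambda>t. enn2real (\<phi> \<bar>x t\<bar>))) else \<infinity>)"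

definition orlicz_space ::
  "'a measure \<Rightarrow> ('a \<Rightarrow> real) set \<Rightarrow> (('a \<Rightarrow> real) \<Rightarrow> real) \<Rightarrow> (real \<Rightarrow> ennreal) \<Rightarrow>
   ('a \<Rightarrow> real) set" where
  "orlicz_space M E N \<phi> =
     {x \<in> borel_measurable M. \<exists>l>0. orlicz_modular M E N \<phi> (\<lambda>t. l * x t) < \<infinity>}"

definition orlicz_norm ::
  "'a measure \<Rightarrow> ('a \<Rightarrow> real) set \<Rightarrow> (('a \<Rightarrow> real) \<Rightarrow> real) \<Rightarrow> (real \<Rightarrow> ennreal) \<Rightarrow>
   ('a \<Rightarrow> real) \<Rightarrow> real" where
  "orlicz_norm M E N \<phi> x = Inf {l. 0 < l \<and> orlicz_modular M E N \<phi> (\<lambda>t. x t / l) \<le> 1}"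

text \<open>
  \<open>P\<close> chooses a representative of the image of each bounded sequence, so its linearity and
  \<open>\<bar>P z\<bar> = P \<bar>z\<bar>\<close> are equalities almost everywhere.
\<close>

definition contains_order_isometric_linf ::
  "'a measure \<Rightarrow> ('a \<Rightarrow> real) set \<Rightarrow> (('a \<Rightarrow> real) \<Rightarrow> real) \<Rightarrow> bool" where
  "contains_order_isometric_linf M F N \<longleftrightarrow>
     (\<exists>P :: (nat \<Rightarrow> real) \<Rightarrow> 'a \<Rightarrow> real.
        (\<forall>z. Bseq z \<longrightarrow> P z \<in> F) \<and>
        (\<forall>z w. Bseq z \<and> Bseq w \<longrightarrow> (AE t in M. P (\<lambda>n. z n + w n) t = P z t + P w t)) \<and>
        (\<forall>z c. Bseq z \<longrightarrow> (AE t in M. P (\<lambda>n. c * z n) t = c * P z t)) \<and>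
        (\<forall>z. Bseq z \<longrightarrow> N (P z) = (SUP n. \<bar>z n\<bar>)) \<and>
        (\<forall>z. Bseq z \<longrightarrow> (AE t in M. \<bar>P z t\<bar> = P (\<lambda>n. \<bar>z n\<bar>) t)))"

end

theory Submission imports Defs begin

text \<open>
  An order isometric copy of \<open>l\<^sub>\<infinity>\<close> is carried by a disjoint sequence: the unit vectors and the
  constant sequence one are sent to disjoint \<open>x n \<ge> 0\<close> and an upper bound \<open>x\<close>, all of norm one.
  Conversely, disjoint positive vectors of norm one in \<open>E\<close> with an upper bound of norm at most one
  span a copy in \<open>E\<close> (\<open>contains_linf_of_disjoint_sequence\<close>). The claim follows by composing with
  \<open>\<phi>\<close>: the vectors \<open>\<phi>(x n)\<close> are disjoint because \<open>\<phi> 0 = 0\<close>, and lie below \<open>\<phi>(x)\<close>. It remains to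
  see that \<open>\<phi>(x n)\<close> and \<open>\<phi>(x)\<close> have norm one in \<open>E\<close>, that is, that norm one in the Orlicz space
  forces modular one.

  One inequality is the Fatou property: \<open>x\<close> is the increasing limit of multiples whose modular is
  at most one, and \<open>\<phi>\<close> is left continuous (\<open>modular_le_1_of_orlicz_norm\<close>). For the other one it
  suffices that every \<open>y\<close> of modular strictly below one admits a dilation \<open>(1 + \<delta>) * y\<close> of modular at
  most one, for then the norm of \<open>y\<close> is at most \<open>1 / (1 + \<delta>)\<close>. In each of the cases this is an
  inequality \<open>\<phi>((1 + \<delta>) * u) \<le> (1 + \<epsilon>) * \<phi>(u)\<close> with \<open>\<epsilon>\<close> small, valid for all relevant \<open>u\<close>, up to an
  additive constant in one case (\<open>modular_gap_Delta2_str\<close>, \<open>modular_gap_Delta2_str_infinity\<close>,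
  \<open>modular_gap_Delta2_str_zero\<close>). The growth condition provides it for large or for small \<open>u\<close>, and
  uniform continuity of \<open>\<phi>\<close> on compact parts of \<open>[0,b)\<close> for the others. When \<open>E \<subseteq> L\<^sub>\<infinity>\<close>, the values
  of \<open>y\<close> stay in such a compact part since the sup norm is bounded by \<open>1/a\<^sub>E\<close> times the norm of \<open>E\<close>;
  that \<open>a\<^sub>E > 0\<close> is a consequence of completeness (\<open>ideal_lower_const_pos\<close>).
\<close>

section \<open>Quasi-Banach ideal spaces\<close>

locale quasi_Banach_ideal =
  fixes M :: "'a measure" and E :: "('a \<Rightarrow> real) set" and N :: "('a \<Rightarrow> real) \<Rightarrow> real"
  assumes quasi_Banach: "quasi_Banach_ideal_space M E N"
begin

lemma measurable_E: "x \<in> E \<Longrightarrow> x \<in> borel_measurable M"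
  using quasi_Banach unfolding quasi_Banach_ideal_space_def quasi_normed_space_def by blast

lemma zero_in_E: "(\<lambda>t. 0) \<in> E"
  using quasi_Banach unfolding quasi_Banach_ideal_space_def quasi_normed_space_def by blast

lemma add_in_E: "x \<in> E \<Longrightarrow> y \<in> E \<Longrightarrow> (\<lambda>t. x t + y t) \<in> E"
  using quasi_Banach unfolding quasi_Banach_ideal_space_def quasi_normed_space_def by blast

lemma scale_in_E: "x \<in> E \<Longrightarrow> (\<lambda>t. c * x t) \<in> E"
  using quasi_Banach unfolding quasi_Banach_ideal_space_def quasi_normed_space_def by blast

lemma norm_nonneg: "x \<in> E \<Longrightarrow> 0 \<le> N x"
  using quasi_Banach unfolding quasi_Banach_ideal_space_def quasi_normed_space_def by blast

lemma norm_eq_0_iff: "x \<in> E \<Longrightarrow> N x = 0 \<longleftrightarrow> (AE t in M. x t = 0)"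
  using quasi_Banach unfolding quasi_Banach_ideal_space_def quasi_normed_space_def by blast

lemma norm_scale: "x \<in> E \<Longrightarrow> N (\<lambda>t. c * x t) = \<bar>c\<bar> * N x"
  using quasi_Banach unfolding quasi_Banach_ideal_space_def quasi_normed_space_def by blast

lemma quasi_triangle:
  obtains C where "C \<ge> 1"
    "\<And>x y. x \<in> E \<Longrightarrow> y \<in> E \<Longrightarrow> N (\<lambda>t. x t + y t) \<le> C * (N x + N y)"
  using quasi_Banach unfolding quasi_Banach_ideal_space_def quasi_normed_space_def by blast

lemma complete_E:
  assumes "\<And>n. x n \<in> E" "\<And>e. e > 0 \<Longrightarrow> \<exists>k. \<forall>m\<ge>k. \<forall>n\<ge>k. N (\<lambda>t. x m t - x n t) < e"
  obtains y where "y \<in> E" "(\<lambda>n. N (\<lambda>t. x n t - y t)) \<longlonglongrightarrow> 0"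
proof -
  have "complete_quasi_norm E N"
    using quasi_Banach unfolding quasi_Banach_ideal_space_def by blast
  then show thesis using assms that unfolding complete_quasi_norm_def by blast
qed

lemma ideal_E:
  assumes "x \<in> borel_measurable M" "y \<in> E" "AE t in M. \<bar>x t\<bar> \<le> \<bar>y t\<bar>"
  shows "x \<in> E" "N x \<le> N y"
  using quasi_Banach assms unfolding quasi_Banach_ideal_space_def ideal_property_def by blast+

lemma diff_in_E: "x \<in> E \<Longrightarrow> y \<in> E \<Longrightarrow> (\<lambda>t. x t - y t) \<in> E"
  using add_in_E[of x "\<lambda>t. (-1) * y t"] scale_in_E[of y "-1"] by simp

text \<open>
  With \<open>C\<close> the constant of the quasi-triangle inequality, the \<open>j\<close>-th term of a sum is multiplied by
  at most \<open>C\<close> to the power \<open>j + 1\<close>; the decay \<open>(2C)\<close> to the power \<open>-(k+1)\<close> outweighs this, so the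
  series converges. Its sum dominates every partial sum because the lattice operations are
  compatible with the quasi-norm.
\<close>

lemma dominating_element_of_fast_sequence:
  assumes C: "C \<ge> 1" "\<And>x y. x \<in> E \<Longrightarrow> y \<in> E \<Longrightarrow> N (\<lambda>t. x t + y t) \<le> C * (N x + N y)"
    and x: "\<And>k. x k \<in> E" "\<And>k t. 0 \<le> x k t" "\<And>k. N (x k) \<le> (1 / (2 * C)) ^ Suc k"
  shows "\<exists>y\<in>E. \<forall>k. AE t in M. x k t \<le> y t"
proof -
  define s where "s n t = (\<Sum>k<n. x k t)" for n t
  have sSuc: "s (Suc n) = (\<lambda>t. s n t + x n t)" for n
    by (auto simp: s_def)
  have sE: "s n \<in> E" for n
  proof (induction n)
    case 0 then show ?case using zero_in_E by (simp add: s_def[abs_def])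
  next
    case (Suc n) then show ?case unfolding sSuc using add_in_E x(1) by blast
  qed
  have tail: "N (\<lambda>t. s (n + j) t - s n t) \<le> (1 / (2 * C)) ^ n" for n j
  proof (induction j arbitrary: n)
    case 0
    have "N (\<lambda>t. 0) = 0" using norm_eq_0_iff[OF zero_in_E] by simp
    then show ?case using C(1) by simp
  next
    case (Suc j)
    have eq: "(\<lambda>t. s (n + Suc j) t - s n t) = (\<lambda>t. x n t + (s (Suc n + j) t - s (Suc n) t))"
      by (simp add: sSuc[of n])
    have "N (\<lambda>t. s (n + Suc j) t - s n t) \<le> C * (N (x n) + N (\<lambda>t. s (Suc n + j) t - s (Suc n) t))"
      unfolding eq by (intro C(2) x(1) diff_in_E sE)
    also have "\<dots> \<le> C * ((1 / (2 * C)) ^ Suc n + (1 / (2 * C)) ^ Suc n)"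
      using C(1) by (intro mult_left_mono add_mono x(3) Suc.IH) auto
    also have "\<dots> = (1 / (2 * C)) ^ n" using C(1) by (simp add: field_simps)
    finally show ?case .
  qed
  have flip: "N (\<lambda>t. s m t - s n t) = N (\<lambda>t. s n t - s m t)" for m n
    using norm_scale[OF diff_in_E[OF sE[of n] sE[of m]], of "-1"] by (simp add: algebra_simps)
  have lim: "(\<lambda>n. (1 / (2 * C)) ^ n) \<longlonglongrightarrow> 0"
    using C(1) by (intro LIMSEQ_power_zero) (simp add: field_simps)
  obtain y where y: "y \<in> E" "(\<lambda>n. N (\<lambda>t. s n t - y t)) \<longlonglongrightarrow> 0"
  proof (rule complete_E[of s])
    show "s n \<in> E" for n by (rule sE)
    fix e :: real assume "e > 0"
    then have "eventually (\<lambda>n. (1 / (2 * C)) ^ n < e) sequentially"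
      using order_tendstoD(2)[OF lim] by blast
    then obtain k where k: "\<And>n. n \<ge> k \<Longrightarrow> (1 / (2 * C)) ^ n < e"
      by (auto simp: eventually_sequentially)
    have *: "N (\<lambda>t. s m t - s n t) < e" if "m \<ge> n" "n \<ge> k" for m n
      using tail[of n "m - n"] k[OF that(2)] that by simp
    show "\<exists>k. \<forall>m\<ge>k. \<forall>n\<ge>k. N (\<lambda>t. s m t - s n t) < e"
      by (intro exI[of _ k] allI impI) (use * flip nat_le_linear in metis)
  qed
  have smono: "s m t \<le> s n t" if "m \<le> n" for m n t
    unfolding s_def using that x(2) by (intro sum_mono2) auto
  have dom: "AE t in M. s m t \<le> y t" for m
  proof -
    let ?d = "\<lambda>t. max 0 (s m t - y t)"
    have dm: "?d \<in> borel_measurable M"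
      using measurable_E[OF sE] measurable_E[OF y(1)] by measurable
    have le: "?d \<in> E \<and> N ?d \<le> N (\<lambda>t. s n t - y t)" if "n \<ge> m" for n
    proof -
      have "\<bar>?d t\<bar> \<le> \<bar>s n t - y t\<bar>" for t using smono[OF that, of t] by (simp add: max_def)
      then have "AE t in M. \<bar>?d t\<bar> \<le> \<bar>s n t - y t\<bar>" by (intro AE_I2)
      then show ?thesis using ideal_E[OF dm diff_in_E[OF sE[of n] y(1)]] by blast
    qed
    have "N ?d \<le> 0"
      by (rule tendsto_lowerbound[OF y(2)]) (auto simp: eventually_sequentially intro!: exI[of _ m] le[THEN conjunct2])
    then have "N ?d = 0" using norm_nonneg le by (meson antisym order_refl)
    then have "AE t in M. ?d t = 0" using norm_eq_0_iff le by blast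
    then show ?thesis by eventually_elim (simp add: max_def split: if_splits)
  qed
  have "AE t in M. x k t \<le> y t" for k
  proof -
    have "x k t \<le> s (Suc k) t" for t
      unfolding s_def using x(2) by (simp add: sum_nonneg)
    then show ?thesis using dom[of "Suc k"] by (auto intro: order_trans)
  qed
  with y(1) show ?thesis by blast
qed

lemma indicator_superlevel_in_E:
  assumes f: "f \<in> E" and c: "0 < c"
  shows "{t \<in> space M. c < f t} \<in> sets M" (is ?A)
    and "(indicator {t \<in> space M. c < f t} :: 'a \<Rightarrow> real) \<in> E" (is ?B)
    and "c * N (indicator {t \<in> space M. c < f t}) \<le> N f" (is ?C)
proof -
  let ?S = "{t \<in> space M. c < f t}"
  have fm: "f \<in> borel_measurable M" by (rule measurable_E[OF f])
  then show S: ?A by measurable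
  have m: "(indicator ?S :: 'a \<Rightarrow> real) \<in> borel_measurable M" using S by simp
  have le: "AE t in M. \<bar>c * indicator ?S t\<bar> \<le> \<bar>f t\<bar>"
    using c by (intro AE_I2) (auto simp: indicator_def)
  have cE: "(\<lambda>t. c * indicator ?S t) \<in> E" "N (\<lambda>t. c * indicator ?S t) \<le> N f"
    using ideal_E[OF _ f le] m by auto
  show B: ?B using scale_in_E[OF cE(1), of "1 / c"] c by simp
  show ?C using norm_scale[OF B, of c] cE(2) c by simp
qed

text \<open>
  Some superlevel set \<open>{1/(n+1) < e}\<close> of a strictly positive \<open>e \<in> E\<close> is not null. Nonemptiness is what
  makes the infimum defining \<open>a\<^sub>E\<close> meaningful.
\<close>

lemma ideal_lower_const_set_nonempty:
  assumes "emeasure M (space M) > 0"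
  shows "{N (indicator A) | A. A \<in> sets M \<and> indicator A \<in> E \<and> 0 < emeasure M A} \<noteq> {}"
proof
  assume empty: "{N (indicator A) | A. A \<in> sets M \<and> indicator A \<in> E \<and> 0 < emeasure M A} = {}"
  obtain e where e: "e \<in> E" "AE t in M. 0 < e t"
    using quasi_Banach unfolding quasi_Banach_ideal_space_def by blast
  have "AE t in M. e t \<le> 1 / Suc n" for n
  proof -
    let ?A = "{t \<in> space M. 1 / Suc n < e t}"
    have "?A \<in> sets M" "(indicator ?A :: 'a \<Rightarrow> real) \<in> E"
      using indicator_superlevel_in_E[OF e(1), of "1 / Suc n"] by auto
    with empty have "emeasure M ?A = 0" by (auto simp: zero_less_iff_neq_zero)
    with \<open>?A \<in> sets M\<close> have "AE t in M. t \<notin> ?A" by (simp add: AE_iff_measurable[OF _ refl] AE_not_in null_setsI)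
    then show ?thesis using AE_space by eventually_elim auto
  qed
  then have "AE t in M. \<forall>n. e t \<le> 1 / Suc n" by (simp add: AE_all_countable)
  then have "AE t in M. False"
    using e(2)
  proof eventually_elim
    case (elim t)
    then show ?case using nat_approx_posE[of "e t"] by (meson leD)
  qed
  then have "emeasure M (space M) = 0" by (simp add: AE_iff_null null_sets_def)
  with assms show False by simp
qed

text \<open>
  If the indicators of sets of positive measure had no positive lower bound in norm, sets \<open>A\<^sub>k\<close>
  with \<open>N (indicator A\<^sub>k)\<close> small enough would make some element of \<open>E\<close> dominate every
  \<open>(k + 1) * indicator A\<^sub>k\<close>, and such an element is not essentially bounded.
\<close>

lemma ideal_lower_const_pos:
  assumes sub: "E \<subseteq> Linfty M" and pos: "emeasure M (space M) > 0"
  shows "ideal_lower_const M E N > 0"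
proof (rule ccontr)
  let ?S = "{N (indicator A) | A. A \<in> sets M \<and> indicator A \<in> E \<and> 0 < emeasure M A}"
  assume "\<not> ideal_lower_const M E N > 0"
  then have Inf: "Inf ?S \<le> 0" by (simp add: ideal_lower_const_def)
  obtain C where C: "C \<ge> 1"
    "\<And>x y. x \<in> E \<Longrightarrow> y \<in> E \<Longrightarrow> N (\<lambda>t. x t + y t) \<le> C * (N x + N y)"
    using quasi_triangle by blast
  have "\<exists>A. A \<in> sets M \<and> indicator A \<in> E \<and> 0 < emeasure M A \<and>
    N (indicator A) < (1 / (2 * C)) ^ Suc k / Suc k" for k
  proof -
    have "Inf ?S < (1 / (2 * C)) ^ Suc k / Suc k"
      using C(1) by (intro order.strict_trans1[OF Inf] divide_pos_pos zero_less_power) simp_all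
    from cInf_lessD[OF ideal_lower_const_set_nonempty[OF pos] this] show ?thesis by blast
  qed
  then obtain A where A: "\<And>k. A k \<in> sets M" "\<And>k. indicator (A k) \<in> E" "\<And>k. 0 < emeasure M (A k)"
    "\<And>k. N (indicator (A k)) < (1 / (2 * C)) ^ Suc k / Suc k" by metis
  define x where "x k t = real (Suc k) * indicator (A k) t" for k t
  have xE: "x k \<in> E" for k unfolding x_def by (rule scale_in_E[OF A(2)])
  have xN: "N (x k) \<le> (1 / (2 * C)) ^ Suc k" for k
  proof -
    have "N (x k) = real (Suc k) * N (indicator (A k))"
      unfolding x_def by (subst norm_scale[OF A(2)]) simp
    also have "\<dots> \<le> real (Suc k) * ((1 / (2 * C)) ^ Suc k / Suc k)"
      by (intro mult_left_mono less_imp_le[OF A(4)]) simp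
    also have "\<dots> = (1 / (2 * C)) ^ Suc k" by (simp del: power_Suc of_nat_Suc)
    finally show ?thesis .
  qed
  have x0: "0 \<le> x k t" for k t by (simp add: x_def)
  obtain y where y: "y \<in> E" "\<And>k. AE t in M. x k t \<le> y t"
    using dominating_element_of_fast_sequence[OF C xE x0 xN] by blast
  obtain c where c: "AE t in M. \<bar>y t\<bar> \<le> c"
    using sub y(1) unfolding Linfty_def by blast
  obtain k where k: "c < real k" using reals_Archimedean2 by blast
  have "AE t in M. t \<notin> A k"
    using c y(2)[of k]
  proof eventually_elim
    case (elim t)
    then show ?case using k by (auto simp: x_def indicator_def)
  qed
  then have "A k \<in> null_sets M" using AE_iff_null_sets[OF A(1)] by blast
  then have "emeasure M (A k) = 0" by (rule null_setsD1)
  with A(3)[of k] show False by simp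
qed

text \<open>
  This is Chebyshev's inequality: where \<open>f\<close> exceeds \<open>c\<close> on a set of positive measure, \<open>c\<close> times the
  norm of its indicator, which is at least \<open>c * a\<^sub>E\<close>, is at most the norm of \<open>f\<close>.
\<close>

lemma ideal_lower_const_bound:
  assumes f: "f \<in> E" and a: "0 < ideal_lower_const M E N"
  shows "AE t in M. f t \<le> N f / ideal_lower_const M E N"
proof -
  let ?a = "ideal_lower_const M E N"
  let ?S = "{N (indicator A) | A. A \<in> sets M \<and> indicator A \<in> E \<and> 0 < emeasure M A}"
  have bdd: "bdd_below ?S" by (rule bdd_belowI[of _ 0]) (auto intro: norm_nonneg)
  have above: "AE t in M. f t \<le> N f / ?a + 1 / Suc n" for n
  proof (rule ccontr)
    assume neg: "\<not> (AE t in M. f t \<le> N f / ?a + 1 / Suc n)"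
    let ?c = "N f / ?a + 1 / Suc n"
    let ?A = "{t \<in> space M. ?c < f t}"
    have c: "0 < ?c" using norm_nonneg[OF f] a by (intro add_nonneg_pos divide_nonneg_pos) simp_all
    note A = indicator_superlevel_in_E[OF f c]
    have "0 < emeasure M ?A"
    proof (rule ccontr)
      assume "\<not> 0 < emeasure M ?A"
      then have "?A \<in> null_sets M" using A(1) by (intro null_setsI) auto
      from AE_not_in[OF this] have "AE t in M. f t \<le> ?c"
        using AE_space by eventually_elim auto
      with neg show False by simp
    qed
    then have "N (indicator ?A) \<in> ?S"
      by (intro CollectI exI[of _ ?A] conjI refl A(1,2))
    then have "?a \<le> N (indicator ?A)"
      unfolding ideal_lower_const_def by (rule cInf_lower[OF _ bdd])
    then have "?c * ?a \<le> N f" using A(3) c by (intro order_trans[OF mult_left_mono A(3)]) (use c in simp_all)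
    then have "?c \<le> N f / ?a" using a by (simp only: pos_le_divide_eq)
    then show False by (simp del: of_nat_Suc)
  qed
  then have "AE t in M. \<forall>n. f t \<le> N f / ?a + 1 / Suc n" by (simp add: AE_all_countable)
  then show ?thesis
  proof eventually_elim
    case (elim t)
    have "(\<lambda>n. N f / ?a + 1 / real (Suc n)) \<longlonglongrightarrow> N f / ?a + 0"
      by (intro tendsto_add tendsto_const LIMSEQ_Suc[OF lim_1_over_n])
    then have "(\<lambda>n. N f / ?a + 1 / real (Suc n)) \<longlonglongrightarrow> N f / ?a" by (simp only: add_0_right)
    then show ?case by (rule LIMSEQ_le_const) (use elim in blast)
  qed
qed

text \<open>
  The Fatou property itself presupposes a real-valued limit. On the set where the limit is infinite,
  truncating at height \<open>k\<close> and letting the sequence increase shows that \<open>k\<close> times the norm of its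
  indicator stays below \<open>c\<close>, so that set is null.
\<close>

lemma Fatou_ennreal:
  assumes Fatou: "Fatou_property M E N"
    and f[measurable]: "f \<in> borel_measurable M"
    and g: "\<And>n. g n \<in> E" "\<And>n. N (g n) \<le> c"
    and lim: "AE t in M. (\<forall>n. 0 \<le> g n t) \<and> incseq (\<lambda>n. g n t) \<and> (\<lambda>n. ennreal (g n t)) \<longlonglongrightarrow> f t"
  shows "AE t in M. f t < \<infinity>" and "(\<lambda>t. enn2real (f t)) \<in> E" and "N (\<lambda>t. enn2real (f t)) \<le> c"
proof -
  have F: "y \<in> E \<and> N y \<le> c"
    if x: "\<And>n. x n \<in> E" "\<And>n. N (x n) \<le> c" and y: "y \<in> borel_measurable M"
      "AE t in M. (\<forall>n. 0 \<le> x n t) \<and> incseq (\<lambda>n. x n t) \<and> (\<lambda>n. x n t) \<longlonglongrightarrow> \<bar>y t\<bar>"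
    for x :: "nat \<Rightarrow> 'a \<Rightarrow> real" and y
  proof -
    have "bdd_above (range (\<lambda>n. N (x n)))" by (rule bdd_aboveI[of _ c]) (use x(2) in auto)
    then have "y \<in> E \<and> (\<lambda>n. N (x n)) \<longlonglongrightarrow> N y"
      using Fatou x(1) y unfolding Fatou_property_def by blast
    then show ?thesis using x(2) by (auto intro: LIMSEQ_le_const2)
  qed
  have gm[measurable]: "g n \<in> borel_measurable M" for n by (rule measurable_E[OF g(1)])
  let ?A = "{t \<in> space M. f t = \<infinity>}"
  have A[measurable]: "?A \<in> sets M" by measurable
  have trunc: "(\<lambda>t. real k * indicator ?A t) \<in> E \<and> N (\<lambda>t. real k * indicator ?A t) \<le> c" for k
  proof (rule F[of "\<lambda>n t. min (g n t) (real k) * indicator ?A t"])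
    have "AE t in M. \<bar>min (g n t) (real k) * indicator ?A t\<bar> \<le> \<bar>g n t\<bar>" for n
      using lim by eventually_elim (auto simp: indicator_def)
    then have *: "(\<lambda>t. min (g n t) (real k) * indicator ?A t) \<in> E \<and>
      N (\<lambda>t. min (g n t) (real k) * indicator ?A t) \<le> N (g n)" for n
      using ideal_E[of "\<lambda>t. min (g n t) (real k) * indicator ?A t", OF _ g(1)[of n]] by simp
    then show "(\<lambda>t. min (g n t) (real k) * indicator ?A t) \<in> E"
      "N (\<lambda>t. min (g n t) (real k) * indicator ?A t) \<le> c" for n
      using g(2)[of n] by (auto intro: order_trans)
    show "AE t in M. (\<forall>n. 0 \<le> min (g n t) (real k) * indicator ?A t) \<and>
      incseq (\<lambda>n. min (g n t) (real k) * indicator ?A t) \<and>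
      (\<lambda>n. min (g n t) (real k) * indicator ?A t) \<longlonglongrightarrow> \<bar>real k * indicator ?A t\<bar>"
      using lim
    proof eventually_elim
      case (elim t)
      have "(\<lambda>n. min (g n t) (real k)) \<longlonglongrightarrow> real k" if "f t = \<infinity>"
      proof -
        have "(\<lambda>n. ennreal (g n t)) \<longlonglongrightarrow> \<infinity>" using elim that by simp
        then have "eventually (\<lambda>n. ennreal (real k) < ennreal (g n t)) sequentially"
          by (rule order_tendstoD(1)) simp
        then have "eventually (\<lambda>n. min (g n t) (real k) = real k) sequentially"
          by eventually_elim (simp add: ennreal_less_iff)
        then show ?thesis by (rule tendsto_eventually)
      qed
      moreover have "min (g m t) (real k) \<le> min (g n t) (real k)" if "m \<le> n" for m n
        using elim that by (meson incseqD min.mono order_refl)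
      ultimately show ?case using elim by (auto simp: indicator_def incseq_def)
    qed
  qed (simp)
  have indE: "(indicator ?A :: 'a \<Rightarrow> real) \<in> E" using trunc[of 1] by simp
  have "N (indicator ?A) \<le> 0"
  proof (rule ccontr)
    assume "\<not> N (indicator ?A) \<le> 0"
    then have pos: "0 < N (indicator ?A)" by simp
    obtain k where "c / N (indicator ?A) < real k" using reals_Archimedean2 by blast
    then have "c < real k * N (indicator ?A)" using pos by (simp add: field_simps)
    also have "\<dots> \<le> c" using trunc[of k] norm_scale[OF indE, of "real k"] by simp
    finally show False by simp
  qed
  then have "N (indicator ?A) = 0" using norm_nonneg[OF indE] by simp
  then have "AE t in M. indicator ?A t = (0::real)" using norm_eq_0_iff[OF indE] by simp
  then show fin: "AE t in M. f t < \<infinity>"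
    using AE_space by eventually_elim (auto simp: indicator_def less_top)
  have "(\<lambda>t. enn2real (f t)) \<in> E \<and> N (\<lambda>t. enn2real (f t)) \<le> c"
  proof (rule F[OF g])
    show "AE t in M. (\<forall>n. 0 \<le> g n t) \<and> incseq (\<lambda>n. g n t) \<and> (\<lambda>n. g n t) \<longlonglongrightarrow> \<bar>enn2real (f t)\<bar>"
      using lim fin
    proof eventually_elim
      case (elim t)
      then have "(\<lambda>n. enn2real (ennreal (g n t))) \<longlonglongrightarrow> enn2real (f t)"
        by (intro tendsto_enn2real) auto
      then show ?case using elim by simp
    qed
  qed simp
  then show "(\<lambda>t. enn2real (f t)) \<in> E" "N (\<lambda>t. enn2real (f t)) \<le> c" by auto
qed

text \<open>
  A disjoint sequence of vectors of norm one with an upper bound of norm one spans the copy: at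
  almost every point only one term of \<open>\<Sum>n. z n * f n t\<close> is nonzero, so the sum lies above each
  \<open>\<bar>z n\<bar> * f n\<close> and below \<open>\<parallel>z\<parallel> * f\<close> in modulus.
\<close>

lemma contains_linf_of_disjoint_sequence:
  fixes f :: "nat \<Rightarrow> 'a \<Rightarrow> real"
  assumes fn: "\<And>n. f n \<in> E" "\<And>n. 1 \<le> N (f n)" and g: "g \<in> E" "N g \<le> 1"
    and le: "\<And>n. AE t in M. 0 \<le> f n t \<and> f n t \<le> g t"
    and disj: "\<And>m n. m \<noteq> n \<Longrightarrow> AE t in M. f m t = 0 \<or> f n t = 0"
  shows "contains_order_isometric_linf M E N"
proof -
  define P where "P z t = (\<Sum>n. z n * f n t)" for z :: "nat \<Rightarrow> real" and t
  have [measurable]: "f n \<in> borel_measurable M" for n by (rule measurable_E[OF fn(1)])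
  have Pm: "P z \<in> borel_measurable M" for z
    unfolding P_def by measurable
  have "AE t in M. \<forall>m n. m \<noteq> n \<longrightarrow> f m t = 0 \<or> f n t = 0"
    using disj by (simp add: AE_all_countable)
  moreover have "AE t in M. \<forall>n. 0 \<le> f n t \<and> f n t \<le> g t"
    using le by (simp add: AE_all_countable)
  ultimately have key: "AE t in M. (\<forall>n. 0 \<le> f n t \<and> f n t \<le> g t) \<and>
      (\<exists>k. (\<forall>n. n \<noteq> k \<longrightarrow> f n t = 0) \<and> (\<forall>z. P z t = z k * f k t))"
  proof eventually_elim
    case (elim t)
    obtain k where k: "\<forall>n. n \<noteq> k \<longrightarrow> f n t = 0"
      using elim by (cases "\<forall>n. f n t = 0") blast+
    have "P z t = z k * f k t" for z
      unfolding P_def using suminf_finite[of "{k}" "\<lambda>n. z n * f n t"] k by simp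
    with k elim show ?case by blast
  qed
  have bound: "\<bar>z n\<bar> \<le> (SUP n. \<bar>z n\<bar>)" if "Bseq z" for z :: "nat \<Rightarrow> real" and n
  proof -
    obtain K where "\<And>n. \<bar>z n\<bar> \<le> K" using \<open>Bseq z\<close> unfolding Bseq_def by auto
    then show ?thesis by (intro cSUP_upper bdd_aboveI[of _ K]) auto
  qed
  have upper: "P z \<in> E \<and> N (P z) \<le> (SUP n. \<bar>z n\<bar>)" if z: "Bseq z" for z
  proof -
    let ?c = "SUP n. \<bar>z n\<bar>"
    have c0: "0 \<le> ?c" using bound[OF z, of 0] by (rule order_trans[OF abs_ge_zero])
    have "AE t in M. \<bar>P z t\<bar> \<le> \<bar>?c * g t\<bar>"
      using key
    proof eventually_elim
      case (elim t)
      then obtain k where k: "P z t = z k * f k t" by blast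
      have "\<bar>z k\<bar> * f k t \<le> ?c * g t" using elim bound[OF z] c0 by (intro mult_mono) auto
      also have "\<dots> \<le> \<bar>?c * g t\<bar>" by simp
      finally show ?case using elim by (simp add: k abs_mult)
    qed
    from ideal_E[OF Pm scale_in_E[OF g(1)] this]
    have "P z \<in> E" "N (P z) \<le> ?c * N g" using norm_scale[OF g(1), of ?c] c0 by auto
    then show ?thesis using mult_left_mono[OF g(2) c0] by auto
  qed
  have lower: "\<bar>z n\<bar> \<le> N (P z)" if z: "Bseq z" for z n
  proof -
    have "AE t in M. \<bar>z n * f n t\<bar> \<le> \<bar>P z t\<bar>"
      using key
    proof eventually_elim
      case (elim t)
      then obtain k where "\<forall>n. n \<noteq> k \<longrightarrow> f n t = 0" "P z t = z k * f k t" by blast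
      then show ?case by (cases "n = k") auto
    qed
    then have "N (\<lambda>t. z n * f n t) \<le> N (P z)" using ideal_E upper[OF z] by simp
    then have "\<bar>z n\<bar> * N (f n) \<le> N (P z)" using norm_scale[OF fn(1)] by simp
    then show ?thesis using mult_left_mono[OF fn(2)[of n], of "\<bar>z n\<bar>"] by simp
  qed
  show ?thesis
    unfolding contains_order_isometric_linf_def
  proof (intro exI[of _ P] conjI allI impI)
    fix z w :: "nat \<Rightarrow> real" and c :: real
    show "AE t in M. P (\<lambda>n. z n + w n) t = P z t + P w t"
      using key by eventually_elim (auto simp: distrib_right)
    show "AE t in M. P (\<lambda>n. c * z n) t = c * P z t"
      using key by eventually_elim auto
    show "AE t in M. \<bar>P z t\<bar> = P (\<lambda>n. \<bar>z n\<bar>) t"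
      using key by eventually_elim (auto simp: abs_mult)
    assume z: "Bseq z"
    show "P z \<in> E" using upper[OF z] by simp
    show "N (P z) = (SUP n. \<bar>z n\<bar>)"
      using upper[OF z] lower[OF z] by (intro antisym cSUP_least) auto
  qed
qed

end


section \<open>Orlicz functions\<close>

lemma orlicz_mono:
  assumes "orlicz_function \<phi>" "0 \<le> u" "u \<le> v"
  shows "\<phi> u \<le> \<phi> v"
  using assms unfolding orlicz_function_def by (auto elim: mono_onD)

lemma orlicz_zero: "orlicz_function \<phi> \<Longrightarrow> \<phi> 0 = 0"
  unfolding orlicz_function_def by blast

lemma orlicz_finite_below_b:
  assumes "orlicz_function \<phi>" "0 \<le> u" "u \<le> c" "ereal c < orlicz_b \<phi>"
  shows "\<phi> u < \<infinity>"
proof -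
  obtain v where "c < v" "\<phi> v < \<infinity>"
    using assms(4) unfolding orlicz_b_def less_Sup_iff by auto
  then show ?thesis
    using orlicz_mono[OF assms(1,2), of v] assms(3) by (simp add: order.strict_trans1)
qed

lemma finite_imp_le_orlicz_b: "0 \<le> u \<Longrightarrow> \<phi> u < \<infinity> \<Longrightarrow> ereal u \<le> orlicz_b \<phi>"
  unfolding orlicz_b_def by (intro Sup_upper) auto

text \<open>The strict sublevel sets are closed downwards, hence empty, a ray or the whole line.\<close>

lemma borel_measurable_mono_ennreal:
  fixes f :: "real \<Rightarrow> ennreal"
  assumes "mono f"
  shows "f \<in> borel_measurable borel"
proof (rule borel_measurableI_less)
  fix y
  define S where "S = {u. f u < y}"
  have down: "v \<in> S" if "u \<in> S" "v \<le> u" for u v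
    using monoD[OF assms that(2)] that(1) by (auto simp: S_def intro: order.strict_trans1)
  have "S \<in> sets borel"
  proof (cases "bdd_above S \<and> S \<noteq> {}")
    case True
    have "v \<in> S" if v: "v < Sup S" for v
    proof -
      obtain u where "u \<in> S" "v < u" using less_cSupD[of S v] True v by blast
      then show ?thesis using down[of u v] by simp
    qed
    moreover have "u \<le> Sup S" if "u \<in> S" for u using True that by (intro cSup_upper) auto
    ultimately have "S = {..<Sup S} \<or> S = {..Sup S}"
      by (cases "Sup S \<in> S") (auto simp: order.order_iff_strict)
    then show ?thesis by (metis borel_closed borel_open closed_atMost open_lessThan)
  next
    case False
    have "S = UNIV" if "S \<noteq> {}"
    proof (intro equalityI subset_UNIV subsetI)
      fix v
      have "\<not> (\<forall>u\<in>S. u \<le> v)" using False that unfolding bdd_above_def by blast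
      then obtain u where "u \<in> S" "v < u" by (auto simp: not_le)
      then show "v \<in> S" using down[of u v] by simp
    qed
    then show ?thesis by (cases "S = {}") auto
  qed
  then show "{u \<in> space borel. f u < y} \<in> sets borel" by (simp add: S_def)
qed

lemma orlicz_measurable:
  assumes \<phi>: "orlicz_function \<phi>" and x: "x \<in> borel_measurable M"
  shows "(\<lambda>t. \<phi> \<bar>x t\<bar>) \<in> borel_measurable M"
proof -
  have "mono (\<lambda>u. \<phi> (max 0 u))"
    by (intro monoI orlicz_mono[OF \<phi>]) auto
  then have "(\<lambda>u. \<phi> (max 0 u)) \<in> borel_measurable borel"
    by (rule borel_measurable_mono_ennreal)
  from measurable_compose[OF borel_measurable_abs[OF x] this] show ?thesis by simp
qed

text \<open>
  The finiteness of \<open>\<phi>(s n)\<close> confines the limit \<open>u\<close> to \<open>(0,b]\<close>, where \<open>\<phi>\<close> is left continuous; the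
  value \<open>\<phi>(u)\<close> may be infinite when \<open>u = b\<close>.
\<close>

lemma orlicz_left_limit:
  assumes \<phi>: "orlicz_function \<phi>" and s: "s \<longlonglongrightarrow> u" "\<And>n. 0 < s n" "\<And>n. s n < u"
    and fin: "\<And>n. \<phi> (s n) < \<infinity>"
  shows "(\<lambda>n. \<phi> (s n)) \<longlonglongrightarrow> \<phi> u"
proof -
  have u: "0 < u" using s(2,3) less_trans by blast
  have "ereal u \<le> orlicz_b \<phi>"
  proof (rule LIMSEQ_le_const2)
    show "(\<lambda>n. ereal (s n)) \<longlonglongrightarrow> ereal u" using s(1) by simp
    have "ereal (s n) \<le> orlicz_b \<phi>" for n
      by (intro finite_imp_le_orlicz_b less_imp_le s fin)
    then show "\<exists>N. \<forall>n\<ge>N. ereal (s n) \<le> orlicz_b \<phi>" by blast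
  qed
  then consider "ereal u < orlicz_b \<phi>" | "orlicz_b \<phi> = ereal u" by force
  then show ?thesis
  proof cases
    case 1
    have "continuous_on {u. 0 < u \<and> ereal u < orlicz_b \<phi>} \<phi>"
      using \<phi> unfolding orlicz_function_def by blast
    moreover have "ereal (s n) < orlicz_b \<phi>" for n
      using 1 s(3)[of n] by (meson ereal_less_eq(3) less_imp_le order.strict_trans1)
    ultimately show ?thesis
      using 1 u s by (auto elim!: continuous_on_tendsto_compose[where f=\<phi>])
  next
    case 2
    then have "(\<phi> \<longlongrightarrow> \<phi> u) (at_left u)"
      using \<phi> unfolding orlicz_function_def by (simp add: continuous_within)
    moreover have "filterlim s (at_left u) sequentially"
      using s by (intro filterlim_at_withinI) auto
    ultimately show ?thesis by (rule filterlim_compose)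
  qed
qed

lemma orlicz_continuous_on:
  assumes \<phi>: "orlicz_function \<phi>" and c: "0 < c" "ereal c < orlicz_b \<phi>"
  shows "continuous_on {0..c} (\<lambda>u. enn2real (\<phi> u))"
proof -
  have "continuous (at u within {0..c}) \<phi>" if u: "u \<in> {0..c}" for u
  proof (cases "u = 0")
    case True
    then show ?thesis
      using \<phi> c(1) unfolding orlicz_function_def by (simp add: at_within_Icc_at_right)
  next
    case False
    let ?U = "{u. 0 < u \<and> ereal u < orlicz_b \<phi>}"
    have "open ({0<..} \<inter> ereal -` {..<orlicz_b \<phi>})"
      by (intro open_Int open_vimage continuous_intros)
    moreover have "?U = {0<..} \<inter> ereal -` {..<orlicz_b \<phi>}" by auto
    ultimately have "open ?U" by simp
    moreover have "u \<in> ?U"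
      using u c(2) False order.strict_trans1[of "ereal u" "ereal c" "orlicz_b \<phi>"] by simp
    moreover have "continuous_on ?U \<phi>"
      using \<phi> unfolding orlicz_function_def by blast
    ultimately have "continuous (at u) \<phi>" by (simp add: continuous_on_eq_continuous_at)
    then show ?thesis by (rule continuous_at_imp_continuous_at_within)
  qed
  moreover have "\<phi> u \<noteq> \<infinity>" if "u \<in> {0..c}" for u
    using orlicz_finite_below_b[OF \<phi>, of u c] that c(2) by auto
  ultimately show ?thesis
    unfolding continuous_on_def continuous_within by (intro ballI tendsto_enn2real) (auto simp: less_top)
qed

text \<open>
  Uniform continuity on a compact interval \<open>[0,c']\<close> with \<open>c < c' < b\<close>, which contains the dilated
  points.
\<close>

lemma orlicz_dilation_near:
  assumes \<phi>: "orlicz_function \<phi>" and c: "0 \<le> c" "ereal c < orlicz_b \<phi>" and \<eta>: "0 < \<eta>"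
  shows "\<exists>\<delta>>0. \<forall>u. 0 \<le> u \<and> u \<le> c \<longrightarrow> \<phi> ((1 + \<delta>) * u) \<le> \<phi> u + ennreal \<eta>"
proof -
  obtain c' where c': "c < c'" "ereal c' < orlicz_b \<phi>"
    using ereal_dense2[OF c(2)] by auto
  have "uniformly_continuous_on {0..c'} (\<lambda>u. enn2real (\<phi> u))"
    using c c' by (intro compact_uniformly_continuous orlicz_continuous_on[OF \<phi>]) auto
  then obtain d where d: "0 < d"
    "\<And>u v. u \<in> {0..c'} \<Longrightarrow> v \<in> {0..c'} \<Longrightarrow> dist v u < d \<Longrightarrow>
      dist (enn2real (\<phi> v)) (enn2real (\<phi> u)) < \<eta>"
    using \<eta> unfolding uniformly_continuous_on_def by metis
  \<comment> \<open>The dilation moves \<open>u \<le> c\<close> by at most \<open>\<delta> * c\<close>; dividing by \<open>c + 1\<close> covers \<open>c = 0\<close>.\<close>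
  define \<delta> where "\<delta> = min (c' - c) (d / 2) / (c + 1)"
  have \<delta>: "0 < \<delta>" using c c' d(1) by (simp add: \<delta>_def)
  have "\<delta> * c \<le> \<delta> * (c + 1)" using \<delta> by simp
  also have "\<dots> = min (c' - c) (d / 2)" using c by (simp add: \<delta>_def)
  finally have \<delta>c: "\<delta> * c \<le> c' - c" "\<delta> * c < d" using d(1) by auto
  have fin: "\<phi> u < \<infinity>" if "0 \<le> u" "u \<le> c'" for u
    using orlicz_finite_below_b[OF \<phi> that c'(2)] .
  have "\<phi> ((1 + \<delta>) * u) \<le> \<phi> u + ennreal \<eta>" if u: "0 \<le> u" "u \<le> c" for u
  proof -
    have \<delta>u: "\<delta> * u \<le> \<delta> * c" "0 \<le> \<delta> * u" using \<delta> u by auto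
    then have v: "0 \<le> (1 + \<delta>) * u" "(1 + \<delta>) * u \<le> c'" "dist ((1 + \<delta>) * u) u < d"
      using u \<delta>c by (auto simp: algebra_simps dist_real_def)
    have uc: "u \<le> c'" using u c' by simp
    have "enn2real (\<phi> ((1 + \<delta>) * u)) \<le> enn2real (\<phi> u) + \<eta>"
      using d(2)[of u "(1 + \<delta>) * u"] u uc v by (auto simp: dist_real_def)
    then have "ennreal (enn2real (\<phi> ((1 + \<delta>) * u))) \<le> ennreal (enn2real (\<phi> u) + \<eta>)"
      by (rule ennreal_leI)
    then show ?thesis using fin[OF v(1,2)] fin[OF u(1) uc] \<eta> by (simp add: less_top)
  qed
  with \<delta> show ?thesis by blast
qed

lemma orlicz_exceeds_below_b:
  assumes \<phi>: "orlicz_function \<phi>" and b: "0 < orlicz_b \<phi>" and v: "ennreal v < orlicz_at_b \<phi>"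
  shows "\<exists>w\<ge>0. ereal w < orlicz_b \<phi> \<and> ennreal v < \<phi> w"
proof (cases "orlicz_b \<phi>")
  case (real \<beta>)
  then have \<beta>: "0 < \<beta>" "\<phi> \<beta> = orlicz_at_b \<phi>" using b by (auto simp: orlicz_at_b_def)
  have "(\<phi> \<longlongrightarrow> \<phi> \<beta>) (at_left \<beta>)"
    using \<phi> real unfolding orlicz_function_def by (simp add: continuous_within)
  then have "eventually (\<lambda>w. ennreal v < \<phi> w) (at_left \<beta>)"
    using v \<beta>(2) by (intro order_tendstoD(1)) auto
  moreover have "eventually (\<lambda>w. w \<in> {0<..<\<beta>}) (at_left \<beta>)"
    using \<beta>(1) by (rule eventually_at_left_real)
  ultimately have "eventually (\<lambda>w. w \<in> {0<..<\<beta>} \<and> ennreal v < \<phi> w) (at_left \<beta>)"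
    by eventually_elim simp
  then obtain w where "w \<in> {0<..<\<beta>}" "ennreal v < \<phi> w"
    using eventually_happens trivial_limit_at_left_real by blast
  then show ?thesis using real by (intro exI[of _ w]) auto
next
  case PInf
  have "(\<phi> \<longlongrightarrow> \<infinity>) at_top" using \<phi> unfolding orlicz_function_def by blast
  then have "eventually (\<lambda>w. ennreal v < \<phi> w) at_top" by (rule order_tendstoD(1)) simp
  with eventually_ge_at_top[of "0::real"] have "eventually (\<lambda>w. 0 \<le> w \<and> ennreal v < \<phi> w) at_top"
    by eventually_elim simp
  then obtain w where "0 \<le> w" "ennreal v < \<phi> w"
    using eventually_happens trivial_limit_at_top_linorder by blast
  then show ?thesis using PInf by auto
next
  case MInf
  then show ?thesis using b by simp
qed

section \<open>The modular\<close>

context quasi_Banach_ideal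
begin

abbreviation modular :: "(real \<Rightarrow> ennreal) \<Rightarrow> ('a \<Rightarrow> real) \<Rightarrow> ennreal" where
  "modular \<equiv> orlicz_modular M E N"

lemma modular_finiteD:
  assumes "modular \<phi> y < \<infinity>"
  shows "AE t in M. \<phi> \<bar>y t\<bar> < \<infinity>" "(\<lambda>t. enn2real (\<phi> \<bar>y t\<bar>)) \<in> E"
    "modular \<phi> y = ennreal (N (\<lambda>t. enn2real (\<phi> \<bar>y t\<bar>)))"
  using assms unfolding orlicz_modular_def by (auto split: if_splits)

lemma modular_le_of_dominated:
  assumes \<phi>: "orlicz_function \<phi>" and w: "w \<in> borel_measurable M" and g: "g \<in> E"
    and le: "AE t in M. \<phi> \<bar>w t\<bar> \<le> ennreal (g t)"
  shows "modular \<phi> w \<le> ennreal (N g)"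
proof -
  have fin: "AE t in M. \<phi> \<bar>w t\<bar> < \<infinity>"
    using le by eventually_elim (simp add: order.strict_trans1)
  have m: "(\<lambda>t. enn2real (\<phi> \<bar>w t\<bar>)) \<in> borel_measurable M"
    using orlicz_measurable[OF \<phi> w] by measurable
  have "AE t in M. \<bar>enn2real (\<phi> \<bar>w t\<bar>)\<bar> \<le> \<bar>g t\<bar>"
    using le
  proof eventually_elim
    case (elim t)
    have "enn2real (\<phi> \<bar>w t\<bar>) \<le> enn2real (ennreal (g t))"
      using elim by (intro enn2real_mono) auto
    also have "\<dots> \<le> \<bar>g t\<bar>" by (cases "0 \<le> g t") (auto simp: ennreal_neg)
    finally show ?case by simp
  qed
  from ideal_E[OF m g this] fin show ?thesis
    unfolding orlicz_modular_def by (simp add: ennreal_leI)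
qed

lemma modular_mono:
  assumes \<phi>: "orlicz_function \<phi>" and w: "w \<in> borel_measurable M"
    and le: "AE t in M. \<bar>w t\<bar> \<le> \<bar>v t\<bar>"
  shows "modular \<phi> w \<le> modular \<phi> v"
proof (cases "modular \<phi> v < \<infinity>")
  case True
  note v = modular_finiteD[OF True]
  have "AE t in M. \<phi> \<bar>w t\<bar> \<le> ennreal (enn2real (\<phi> \<bar>v t\<bar>))"
    using le v(1) by eventually_elim (simp add: orlicz_mono[OF \<phi>] less_top)
  from modular_le_of_dominated[OF \<phi> w v(2) this] show ?thesis by (simp add: v(3))
next
  case False
  then show ?thesis by (simp add: not_less top_unique)
qed

text \<open>
  The common frame of the three growth conditions, each of which supplies its own \<open>g\<close>. The dilation
  can push values of \<open>y\<close> beyond \<open>b\<close>; the domination by the real-valued \<open>g\<close> excludes this.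
\<close>

lemma modular_gap_of_dominated:
  assumes \<phi>: "orlicz_function \<phi>" and y: "y \<in> borel_measurable M" "modular \<phi> y < 1"
    and \<delta>: "0 < \<delta>" and g: "g \<in> E" "N g \<le> 1"
    and le: "AE t in M. \<phi> \<bar>y t\<bar> < \<infinity> \<longrightarrow> \<phi> ((1 + \<delta>) * \<bar>y t\<bar>) \<le> ennreal (g t)"
  shows "\<exists>\<delta>>0. modular \<phi> (\<lambda>t. (1 + \<delta>) * y t) \<le> 1"
proof -
  have "modular \<phi> y < \<infinity>" using y(2) by (rule less_trans) simp
  then have "AE t in M. \<phi> \<bar>(1 + \<delta>) * y t\<bar> \<le> ennreal (g t)"
    using le modular_finiteD(1) \<delta> by (force simp: abs_mult)
  then have "modular \<phi> (\<lambda>t. (1 + \<delta>) * y t) \<le> ennreal (N g)"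
    using y(1) by (intro modular_le_of_dominated[OF \<phi> _ g(1)]) auto
  also have "\<dots> \<le> 1" using g(2) by simp
  finally show ?thesis using \<delta> by blast
qed

lemma modular_less_1D:
  assumes "modular \<phi> y < 1"
  obtains \<epsilon> where "0 < \<epsilon>" "(1 + \<epsilon>) * N (\<lambda>t. enn2real (\<phi> \<bar>y t\<bar>)) < 1"
    "AE t in M. \<phi> \<bar>y t\<bar> < \<infinity>" "(\<lambda>t. enn2real (\<phi> \<bar>y t\<bar>)) \<in> E"
    "N (\<lambda>t. enn2real (\<phi> \<bar>y t\<bar>)) < 1"
proof -
  let ?f = "\<lambda>t. enn2real (\<phi> \<bar>y t\<bar>)"
  have "modular \<phi> y < \<infinity>" using assms by (rule less_trans) simp
  note y = modular_finiteD[OF this]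
  have r: "N ?f < 1" using assms y(3) by simp
  have r0: "0 \<le> N ?f" by (rule norm_nonneg[OF y(2)])
  \<comment> \<open>With \<open>r = N f\<close>, the choice \<open>\<epsilon> = 1 - r\<close> works since \<open>(2 - r) * r = 1 - (1 - r)\<^sup>2\<close>.\<close>
  have "(1 - N ?f) * N ?f < (1 - N ?f) * 1" using r by (intro mult_strict_left_mono) auto
  then have "(1 + (1 - N ?f)) * N ?f < 1" by (simp add: algebra_simps)
  with r y that[of "1 - N ?f"] show thesis by simp
qed

lemma modular_gap_Delta2_str:
  assumes \<phi>: "orlicz_function \<phi>" and \<Delta>: "Delta2_str \<phi>"
    and y: "y \<in> borel_measurable M" "modular \<phi> y < 1"
  shows "\<exists>\<delta>>0. modular \<phi> (\<lambda>t. (1 + \<delta>) * y t) \<le> 1"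
proof -
  let ?f = "\<lambda>t. enn2real (\<phi> \<bar>y t\<bar>)"
  obtain \<epsilon> where \<epsilon>: "0 < \<epsilon>" "(1 + \<epsilon>) * N ?f < 1" and f: "?f \<in> E"
    by (rule modular_less_1D[OF y(2)])
  obtain \<delta> where \<delta>: "\<delta> > 0" "\<And>u. 0 \<le> u \<Longrightarrow> \<phi> ((1 + \<delta>) * u) \<le> ennreal (1 + \<epsilon>) * \<phi> u"
    using \<Delta> \<epsilon>(1) unfolding Delta2_str_def by meson
  show ?thesis
  proof (rule modular_gap_of_dominated[OF \<phi> y \<delta>(1) scale_in_E[OF f, of "1 + \<epsilon>"]])
    show "N (\<lambda>t. (1 + \<epsilon>) * ?f t) \<le> 1" using \<epsilon> norm_scale[OF f, of "1 + \<epsilon>"] by simp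
    show "AE t in M. \<phi> \<bar>y t\<bar> < \<infinity> \<longrightarrow> \<phi> ((1 + \<delta>) * \<bar>y t\<bar>) \<le> ennreal ((1 + \<epsilon>) * ?f t)"
      using \<delta>(2) \<epsilon>(1) by (intro AE_I2) (simp add: ennreal_mult less_top)
  qed
qed

text \<open>
  Below the threshold of the growth condition, uniform continuity bounds the increase of \<open>\<phi>\<close> under
  a small dilation by a constant \<open>\<eta>\<close>. Constants belong to \<open>E\<close>, and the triangle inequality with
  constant one keeps the norm of \<open>(1 + \<epsilon>) * f + \<eta>\<close> below one.
\<close>

lemma modular_gap_Delta2_str_infinity:
  assumes \<phi>: "orlicz_function \<phi>" and \<Delta>: "Delta2_str_infinity \<phi>"
    and B: "Banach_ideal_space M E N" and sub: "Linfty M \<subseteq> E"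
    and y: "y \<in> borel_measurable M" "modular \<phi> y < 1"
  shows "\<exists>\<delta>>0. modular \<phi> (\<lambda>t. (1 + \<delta>) * y t) \<le> 1"
proof -
  let ?f = "\<lambda>t. enn2real (\<phi> \<bar>y t\<bar>)"
  obtain \<epsilon> where \<epsilon>: "0 < \<epsilon>" "(1 + \<epsilon>) * N ?f < 1" and f: "?f \<in> E"
    by (rule modular_less_1D[OF y(2)])
  obtain \<delta>1 u0 where \<delta>1: "\<delta>1 > 0" "u0 > 0" "\<phi> u0 < \<infinity>"
    "\<And>u. u0 \<le> u \<Longrightarrow> \<phi> ((1 + \<delta>1) * u) \<le> ennreal (1 + \<epsilon>) * \<phi> u"
    using \<Delta> \<epsilon>(1) unfolding Delta2_str_infinity_def by meson
  \<comment> \<open>The growth condition at \<open>u0\<close> itself puts \<open>(1 + \<delta>1) * u0\<close> into the domain of finiteness.\<close>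
  have "\<phi> ((1 + \<delta>1) * u0) \<le> ennreal (1 + \<epsilon>) * \<phi> u0" using \<delta>1(4) by simp
  also have "\<dots> < \<infinity>" using \<delta>1(3) by (simp add: ennreal_mult_less_top)
  finally have "ereal ((1 + \<delta>1) * u0) \<le> orlicz_b \<phi>"
    using \<delta>1 by (intro finite_imp_le_orlicz_b) auto
  moreover have "ereal u0 < ereal ((1 + \<delta>1) * u0)" using \<delta>1 by simp
  ultimately have b: "ereal u0 < orlicz_b \<phi>" by (rule order.strict_trans2[rotated])
  have one: "(\<lambda>t. 1) \<in> E" using sub by (auto simp: Linfty_def intro!: exI[of _ 1])
  define \<eta> where "\<eta> = (1 - (1 + \<epsilon>) * N ?f) / (N (\<lambda>t. 1) + 1)"
  have \<eta>: "0 < \<eta>" using \<epsilon> norm_nonneg[OF one] by (simp add: \<eta>_def)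
  obtain \<delta>2 where \<delta>2: "\<delta>2 > 0" "\<And>u. 0 \<le> u \<Longrightarrow> u \<le> u0 \<Longrightarrow> \<phi> ((1 + \<delta>2) * u) \<le> \<phi> u + ennreal \<eta>"
    using orlicz_dilation_near[OF \<phi> less_imp_le[OF \<delta>1(2)] b \<eta>] by blast
  define \<delta> where "\<delta> = min \<delta>1 \<delta>2"
  have \<delta>: "0 < \<delta>" using \<delta>1 \<delta>2 by (simp add: \<delta>_def)
  let ?g = "\<lambda>t. (1 + \<epsilon>) * ?f t + \<eta> * 1"
  have gE: "?g \<in> E" by (intro add_in_E scale_in_E f one)
  show ?thesis
  proof (rule modular_gap_of_dominated[OF \<phi> y \<delta> gE])
    have "\<eta> * N (\<lambda>t. 1) \<le> \<eta> * (N (\<lambda>t. 1) + 1)" using \<eta> by simp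
    also have "\<dots> = 1 - (1 + \<epsilon>) * N ?f" using norm_nonneg[OF one] by (simp add: \<eta>_def)
    finally have *: "\<eta> * N (\<lambda>t. 1) \<le> 1 - (1 + \<epsilon>) * N ?f" .
    have tri: "N (\<lambda>t. u t + v t) \<le> N u + N v" if "u \<in> E" "v \<in> E" for u v
      using B that unfolding Banach_ideal_space_def by blast
    have "N ?g \<le> N (\<lambda>t. (1 + \<epsilon>) * ?f t) + N (\<lambda>t. \<eta> * 1)"
      by (rule tri[OF scale_in_E[OF f] scale_in_E[OF one]])
    also have "\<dots> = (1 + \<epsilon>) * N ?f + \<eta> * N (\<lambda>t. 1)"
      using norm_scale[OF f, of "1 + \<epsilon>"] norm_scale[OF one, of \<eta>] \<epsilon>(1) \<eta> by simp
    finally show "N ?g \<le> 1" using * by simp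
    have "\<phi> ((1 + \<delta>) * u) \<le> ennreal (1 + \<epsilon>) * \<phi> u + ennreal \<eta>" if u: "0 \<le> u" for u
    proof (cases "u \<le> u0")
      case True
      have "\<phi> ((1 + \<delta>) * u) \<le> \<phi> ((1 + \<delta>2) * u)"
        using \<delta> u by (intro orlicz_mono[OF \<phi>] mult_right_mono) (auto simp: \<delta>_def)
      also have "\<dots> \<le> 1 * \<phi> u + ennreal \<eta>" using \<delta>2(2) u True by simp
      also have "\<dots> \<le> ennreal (1 + \<epsilon>) * \<phi> u + ennreal \<eta>"
        using \<epsilon>(1) by (intro add_mono mult_right_mono) auto
      finally show ?thesis .
    next
      case False
      have "\<phi> ((1 + \<delta>) * u) \<le> \<phi> ((1 + \<delta>1) * u)"
        using \<delta> u by (intro orlicz_mono[OF \<phi>] mult_right_mono) (auto simp: \<delta>_def)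
      also have "\<dots> \<le> ennreal (1 + \<epsilon>) * \<phi> u" using \<delta>1(4) False by simp
      finally show ?thesis by (simp add: add_increasing2)
    qed
    then show "AE t in M. \<phi> \<bar>y t\<bar> < \<infinity> \<longrightarrow> \<phi> ((1 + \<delta>) * \<bar>y t\<bar>) \<le> ennreal (?g t)"
      using \<epsilon>(1) \<eta> by (intro AE_I2) (simp add: ennreal_mult less_top)
  qed
qed

text \<open>
  A modular below one confines the values of \<open>y\<close> to an interval \<open>[0,w]\<close> with \<open>w < b\<close>, because
  \<open>\<phi>(\<bar>y\<bar>)\<close> is bounded by something strictly below \<open>1/a\<^sub>E\<close>, hence strictly below \<open>\<phi>(b)\<close>. Between the
  threshold \<open>u0\<close> of the growth condition and \<open>w\<close>, the function \<open>\<phi>\<close> is bounded away from zero, so the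
  additive bound of uniform continuity is also a multiplicative one.
\<close>

lemma modular_gap_Delta2_str_zero:
  assumes \<phi>: "orlicz_function \<phi>" and b: "0 < orlicz_b \<phi>" and \<Delta>: "Delta2_str_zero \<phi>"
    and a: "0 < ideal_lower_const M E N"
    and ab: "ennreal (1 / ideal_lower_const M E N) \<le> orlicz_at_b \<phi>"
    and y: "y \<in> borel_measurable M" "modular \<phi> y < 1"
  shows "\<exists>\<delta>>0. modular \<phi> (\<lambda>t. (1 + \<delta>) * y t) \<le> 1"
proof -
  let ?f = "\<lambda>t. enn2real (\<phi> \<bar>y t\<bar>)" and ?a = "ideal_lower_const M E N"
  obtain \<epsilon> where \<epsilon>: "0 < \<epsilon>" "(1 + \<epsilon>) * N ?f < 1" and f: "?f \<in> E" and r: "N ?f < 1"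
    by (rule modular_less_1D[OF y(2)])
  have "ennreal (N ?f / ?a) < ennreal (1 / ?a)"
    using r a by (intro ennreal_lessI divide_strict_right_mono) auto
  then have "ennreal (N ?f / ?a) < orlicz_at_b \<phi>" using ab by (rule order.strict_trans2)
  then obtain w where w: "0 \<le> w" "ereal w < orlicz_b \<phi>" "ennreal (N ?f / ?a) < \<phi> w"
    using orlicz_exceeds_below_b[OF \<phi> b] by blast
  obtain \<delta>1 u0 where \<delta>1: "\<delta>1 > 0" "u0 > 0" "0 < \<phi> u0"
    "\<And>u. 0 \<le> u \<Longrightarrow> u \<le> u0 \<Longrightarrow> \<phi> ((1 + \<delta>1) * u) \<le> ennreal (1 + \<epsilon>) * \<phi> u"
    using \<Delta> \<epsilon>(1) unfolding Delta2_str_zero_def by meson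
  obtain m where m: "0 < m" "ennreal m \<le> \<phi> u0"
  proof (cases "\<phi> u0")
    case (real q)
    then show thesis using that[of q] \<delta>1(3) by simp
  next
    case top
    then show thesis using that[of 1] by simp
  qed
  obtain \<delta>2 where \<delta>2: "\<delta>2 > 0"
    "\<And>u. 0 \<le> u \<Longrightarrow> u \<le> w \<Longrightarrow> \<phi> ((1 + \<delta>2) * u) \<le> \<phi> u + ennreal (\<epsilon> * m)"
    using orlicz_dilation_near[OF \<phi> w(1,2), of "\<epsilon> * m"] \<epsilon>(1) m(1) by auto
  define \<delta> where "\<delta> = min \<delta>1 \<delta>2"
  have \<delta>: "0 < \<delta>" using \<delta>1 \<delta>2 by (simp add: \<delta>_def)
  have growth: "\<phi> ((1 + \<delta>) * u) \<le> ennreal (1 + \<epsilon>) * \<phi> u" if u: "0 \<le> u" "u \<le> w" for u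
  proof (cases "u \<le> u0")
    case True
    have "\<phi> ((1 + \<delta>) * u) \<le> \<phi> ((1 + \<delta>1) * u)"
      using \<delta> u by (intro orlicz_mono[OF \<phi>] mult_right_mono) (auto simp: \<delta>_def)
    also have "\<dots> \<le> ennreal (1 + \<epsilon>) * \<phi> u" using \<delta>1(4) u True by simp
    finally show ?thesis .
  next
    case False
    have "\<phi> ((1 + \<delta>) * u) \<le> \<phi> ((1 + \<delta>2) * u)"
      using \<delta> u by (intro orlicz_mono[OF \<phi>] mult_right_mono) (auto simp: \<delta>_def)
    also have "\<dots> \<le> \<phi> u + ennreal \<epsilon> * ennreal m"
      using \<delta>2(2) u \<epsilon>(1) m(1) by (simp add: ennreal_mult)
    also have "\<dots> \<le> \<phi> u + ennreal \<epsilon> * \<phi> u"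
      using m(2) orlicz_mono[OF \<phi>, of u0 u] False \<delta>1(2)
      by (intro add_left_mono mult_left_mono) (auto intro: order_trans)
    also have "\<dots> = ennreal (1 + \<epsilon>) * \<phi> u" using \<epsilon>(1) by (simp add: distrib_right)
    finally show ?thesis .
  qed
  show ?thesis
  proof (rule modular_gap_of_dominated[OF \<phi> y \<delta> scale_in_E[OF f, of "1 + \<epsilon>"]])
    show "N (\<lambda>t. (1 + \<epsilon>) * ?f t) \<le> 1" using \<epsilon> norm_scale[OF f, of "1 + \<epsilon>"] by simp
    show "AE t in M. \<phi> \<bar>y t\<bar> < \<infinity> \<longrightarrow> \<phi> ((1 + \<delta>) * \<bar>y t\<bar>) \<le> ennreal ((1 + \<epsilon>) * ?f t)"
      using ideal_lower_const_bound[OF f a]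
    proof eventually_elim
      case (elim t)
      show ?case
      proof
        assume fin: "\<phi> \<bar>y t\<bar> < \<infinity>"
        then have "\<phi> \<bar>y t\<bar> = ennreal (?f t)" by (simp add: less_top)
        also have "\<dots> \<le> ennreal (N ?f / ?a)" using elim by (rule ennreal_leI)
        also have "\<dots> < \<phi> w" by (rule w(3))
        finally have "\<bar>y t\<bar> \<le> w" using orlicz_mono[OF \<phi> w(1), of "\<bar>y t\<bar>"] by (meson leD linear)
        then show "\<phi> ((1 + \<delta>) * \<bar>y t\<bar>) \<le> ennreal ((1 + \<epsilon>) * ?f t)"
          using growth[of "\<bar>y t\<bar>"] fin \<epsilon>(1) by (simp add: ennreal_mult less_top)
      qed
    qed
  qed
qed

section \<open>Transfer of the copy\<close>

text \<open>
  The points \<open>x / (1 + 1 / (n + 1))\<close> have modular at most one and increase in modulus to \<open>x\<close>, so left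
  continuity of \<open>\<phi>\<close> and the Fatou property give the bound for \<open>x\<close> itself.
\<close>

lemma modular_le_1_of_orlicz_norm:
  assumes Fatou: "Fatou_property M E N" and \<phi>: "orlicz_function \<phi>"
    and x: "x \<in> borel_measurable M" "orlicz_norm M E N \<phi> x \<le> 1"
    and ne: "\<exists>l>0. modular \<phi> (\<lambda>t. x t / l) \<le> 1"
  shows "modular \<phi> x \<le> 1"
proof -
  define l where "l n = 1 + 1 / real (Suc n)" for n
  have l1: "1 < l n" for n by (simp add: l_def)
  have ldec: "l n \<le> l m" if "m \<le> n" for m n using that by (simp add: l_def frac_le)
  have llim: "l \<longlonglongrightarrow> 1"
  proof -
    have "l \<longlonglongrightarrow> 1 + 0" unfolding l_def by (intro tendsto_intros LIMSEQ_Suc[OF lim_1_over_n])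
    then show ?thesis by simp
  qed
  have ml: "modular \<phi> (\<lambda>t. x t / l n) \<le> 1" for n
  proof -
    have "Inf {l. 0 < l \<and> modular \<phi> (\<lambda>t. x t / l) \<le> 1} < l n"
      using x(2) l1[of n] by (simp add: orlicz_norm_def)
    moreover have "{l. 0 < l \<and> modular \<phi> (\<lambda>t. x t / l) \<le> 1} \<noteq> {}" using ne by blast
    ultimately obtain l' where "l' \<in> {l. 0 < l \<and> modular \<phi> (\<lambda>t. x t / l) \<le> 1}" "l' < l n"
      by (metis (no_types, lifting) cInf_lessD)
    then have l': "0 < l'" "modular \<phi> (\<lambda>t. x t / l') \<le> 1" "l' < l n" by auto
    have "\<bar>x t / l n\<bar> \<le> \<bar>x t / l'\<bar>" for t
      using l'(1,3) by (simp add: abs_divide divide_left_mono)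
    then have "modular \<phi> (\<lambda>t. x t / l n) \<le> modular \<phi> (\<lambda>t. x t / l')"
      using x(1) by (intro modular_mono[OF \<phi>]) auto
    then show ?thesis using l'(2) by (rule order_trans)
  qed
  define g where "g n t = enn2real (\<phi> \<bar>x t / l n\<bar>)" for n t
  have mfin: "modular \<phi> (\<lambda>t. x t / l n) < \<infinity>" for n
    using ml[of n] by (rule order.strict_trans1) simp
  have gE: "g n \<in> E" for n using modular_finiteD(2)[OF mfin[of n]] by (simp add: g_def[abs_def])
  have gN: "N (g n) \<le> 1" for n
    using modular_finiteD(3)[OF mfin[of n]] ml[of n] by (simp add: g_def[abs_def])
  have "AE t in M. \<forall>n. \<phi> \<bar>x t / l n\<bar> < \<infinity>"
    using modular_finiteD(1)[OF mfin] by (simp add: AE_all_countable)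
  then have lim: "AE t in M. (\<forall>n. 0 \<le> g n t) \<and> incseq (\<lambda>n. g n t) \<and>
    (\<lambda>n. ennreal (g n t)) \<longlonglongrightarrow> \<phi> \<bar>x t\<bar>"
  proof eventually_elim
    case (elim t)
    have le: "\<bar>x t / l m\<bar> \<le> \<bar>x t / l n\<bar>" if "m \<le> n" for m n
      using ldec[OF that] l1[of m] l1[of n] by (simp add: abs_divide divide_left_mono)
    have inc: "incseq (\<lambda>n. g n t)"
      unfolding g_def by (intro incseq_SucI enn2real_mono orlicz_mono[OF \<phi>] le) (use elim in auto)
    have "(\<lambda>n. \<phi> \<bar>x t / l n\<bar>) \<longlonglongrightarrow> \<phi> \<bar>x t\<bar>"
    proof (cases "x t = 0")
      case False
      have "(\<lambda>n. \<bar>x t / l n\<bar>) \<longlonglongrightarrow> \<bar>x t / 1\<bar>" by (intro tendsto_intros llim) simp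
      moreover have "\<bar>x t / l n\<bar> < \<bar>x t\<bar>" for n
        using l1[of n] False by (simp add: abs_divide divide_less_eq)
      moreover have "0 < \<bar>x t / l n\<bar>" for n using l1[of n] False by simp
      ultimately show ?thesis using elim by (intro orlicz_left_limit[OF \<phi>]) auto
    qed simp
    then show ?case using inc elim by (simp add: g_def less_top)
  qed
  note F = Fatou_ennreal[OF Fatou orlicz_measurable[OF \<phi> x(1)] gE gN lim]
  then show ?thesis unfolding orlicz_modular_def by simp
qed

lemma orlicz_norm_le:
  assumes "0 < l" "modular \<phi> (\<lambda>t. x t / l) \<le> 1"
  shows "orlicz_norm M E N \<phi> x \<le> l"
  unfolding orlicz_norm_def using assms by (intro cInf_lower bdd_belowI[of _ 0]) auto

text \<open>
  The unit vectors and the constant sequence one are mapped to disjoint \<open>x n \<ge> 0\<close> and an upper bound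
  \<open>x\<close>, all of norm one; a modular of \<open>x n\<close> below one would leave room for a dilation and hence
  contradict its norm. Thus \<open>\<phi>(x n)\<close> and \<open>\<phi>(x)\<close> satisfy the hypotheses of the disjoint sequence
  criterion.
\<close>

lemma contains_linf_of_modular_gap:
  assumes Fatou: "Fatou_property M E N" and \<phi>: "orlicz_function \<phi>"
    and gap: "\<And>y. y \<in> borel_measurable M \<Longrightarrow> modular \<phi> y < 1 \<Longrightarrow>
      \<exists>\<delta>>0. modular \<phi> (\<lambda>t. (1 + \<delta>) * y t) \<le> 1"
    and copy: "contains_order_isometric_linf M (orlicz_space M E N \<phi>) (orlicz_norm M E N \<phi>)"
  shows "contains_order_isometric_linf M E N"
proof -
  obtain P :: "(nat \<Rightarrow> real) \<Rightarrow> 'a \<Rightarrow> real" where P: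
    "\<forall>z. Bseq z \<longrightarrow> P z \<in> orlicz_space M E N \<phi>"
    "\<forall>z w. Bseq z \<and> Bseq w \<longrightarrow> (AE t in M. P (\<lambda>n. z n + w n) t = P z t + P w t)"
    "\<forall>z c. Bseq z \<longrightarrow> (AE t in M. P (\<lambda>n. c * z n) t = c * P z t)"
    "\<forall>z. Bseq z \<longrightarrow> orlicz_norm M E N \<phi> (P z) = (SUP n. \<bar>z n\<bar>)"
    "\<forall>z. Bseq z \<longrightarrow> (AE t in M. \<bar>P z t\<bar> = P (\<lambda>n. \<bar>z n\<bar>) t)"
    using copy unfolding contains_order_isometric_linf_def by (elim exE conjE) (rule that)
  note PE = P(1)[rule_format] and Padd = P(2)[rule_format, OF conjI]
    and Pscale = P(3)[rule_format] and Pnorm = P(4)[rule_format] and Pabs = P(5)[rule_format]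
  have Pm: "P z \<in> borel_measurable M" if "Bseq z" for z
    using PE[OF that] unfolding orlicz_space_def by blast
  have Pdiff: "AE t in M. P (\<lambda>n. z n - w n) t = P z t - P w t" if "Bseq z" "Bseq w" for z w
  proof -
    have "Bseq (\<lambda>n. (-1) * w n)" using that(2) by (simp add: Bseq_minus_iff)
    from Padd[OF that(1) this] Pscale[OF that(2), of "-1"] show ?thesis
      by eventually_elim simp
  qed
  define e :: "nat \<Rightarrow> nat \<Rightarrow> real" where "e n k = (if k = n then 1 else 0)" for n k
  define one :: "nat \<Rightarrow> real" where "one k = 1" for k
  have Be: "Bseq (e n)" for n by (rule BseqI'[of _ 1]) (simp add: e_def)
  have Bone: "Bseq one" by (rule BseqI'[of _ 1]) (simp add: one_def)
  have Ne: "orlicz_norm M E N \<phi> (P (e n)) = 1" for n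
    unfolding Pnorm[OF Be] by (rule cSup_eq_maximum) (auto simp: e_def intro!: image_eqI[of _ _ n])
  have None1: "orlicz_norm M E N \<phi> (P one) = 1"
    unfolding Pnorm[OF Bone] by (simp add: one_def)
  have e_nonneg: "AE t in M. 0 \<le> P (e n) t" for n
  proof -
    have "(\<lambda>k. \<bar>e n k\<bar>) = e n" by (auto simp: e_def)
    then have "AE t in M. \<bar>P (e n) t\<bar> = P (e n) t" using Pabs[OF Be[of n]] by simp
    then show ?thesis by eventually_elim linarith
  qed
  have e_le: "AE t in M. P (e n) t \<le> P one t" for n
  proof -
    have B: "Bseq (\<lambda>k. one k - e n k)" by (rule BseqI'[of _ 1]) (simp add: e_def one_def)
    have "(\<lambda>k. \<bar>one k - e n k\<bar>) = (\<lambda>k. one k - e n k)" by (auto simp: e_def one_def)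
    then have "AE t in M. \<bar>P (\<lambda>k. one k - e n k) t\<bar> = P (\<lambda>k. one k - e n k) t"
      using Pabs[OF B] by simp
    then show ?thesis using Pdiff[OF Bone Be[of n]] by eventually_elim linarith
  qed
  have e_disj: "AE t in M. P (e m) t = 0 \<or> P (e n) t = 0" if "m \<noteq> n" for m n
  proof -
    have B: "Bseq (\<lambda>k. e m k - e n k)" by (rule BseqI'[of _ 1]) (simp add: e_def)
    have "(\<lambda>k. \<bar>e m k - e n k\<bar>) = (\<lambda>k. e m k + e n k)" using that by (auto simp: e_def)
    then have "AE t in M. \<bar>P (\<lambda>k. e m k - e n k) t\<bar> = P (\<lambda>k. e m k + e n k) t"
      using Pabs[OF B] by simp
    then show ?thesis using Pdiff[OF Be[of m] Be[of n]] Padd[OF Be[of m] Be[of n]]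
      by eventually_elim (auto simp: abs_if split: if_splits)
  qed
  \<comment> \<open>Over the empty set, \<open>Inf\<close> is an unspecified real number. If the set defining the norm of
    \<open>P one\<close> were empty, so would be the one of \<open>P (2 * one)\<close>; both norms would be this number,
    whereas they are 1 and 2.\<close>
  have ne: "\<exists>l>0. modular \<phi> (\<lambda>t. P one t / l) \<le> 1"
  proof (rule ccontr)
    assume none: "\<not> ?thesis"
    let ?two = "\<lambda>k. 2 * one k"
    have B2: "Bseq ?two" by (rule BseqI'[of _ 2]) (simp add: one_def)
    have "modular \<phi> (\<lambda>t. P one t / (l / 2)) \<le> modular \<phi> (\<lambda>t. P ?two t / l)" for l
      using Pscale[OF Bone, of 2] Pm[OF Bone]
      by (intro modular_mono[OF \<phi>]) (auto elim!: eventually_mono simp: mult.commute)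
    with none have "\<not> (0 < l \<and> modular \<phi> (\<lambda>t. P ?two t / l) \<le> 1)" for l
      by (meson half_gt_zero order_trans)
    with none have "orlicz_norm M E N \<phi> (P ?two) = orlicz_norm M E N \<phi> (P one)"
      unfolding orlicz_norm_def by (intro arg_cong[where f=Inf]) blast
    moreover have "orlicz_norm M E N \<phi> (P ?two) = 2"
      unfolding Pnorm[OF B2] by (simp add: one_def)
    ultimately show False using None1 by simp
  qed
  define f where "f n t = enn2real (\<phi> \<bar>P (e n) t\<bar>)" for n t
  define g where "g t = enn2real (\<phi> \<bar>P one t\<bar>)" for t
  have m1: "modular \<phi> (P one) \<le> 1"
    using None1 by (intro modular_le_1_of_orlicz_norm[OF Fatou \<phi> Pm[OF Bone] _ ne]) simp
  have fin1: "modular \<phi> (P one) < \<infinity>" using m1 by (rule order.strict_trans1) simp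
  have gE: "g \<in> E" using modular_finiteD(2)[OF fin1] by (simp add: g_def[abs_def])
  have gN: "N g \<le> 1" using modular_finiteD(3)[OF fin1] m1 by (simp add: g_def[abs_def])
  have "AE t in M. \<bar>P (e n) t\<bar> \<le> \<bar>P one t\<bar>" for n
    using e_nonneg[of n] e_le[of n] by eventually_elim simp
  note abs_le = this
  have finn: "modular \<phi> (P (e n)) < \<infinity>" for n
    using modular_mono[OF \<phi> Pm[OF Be] abs_le] fin1 by (rule order.strict_trans1)
  have fE: "f n \<in> E" for n using modular_finiteD(2)[OF finn[of n]] by (simp add: f_def[abs_def])
  have fN: "1 \<le> N (f n)" for n
  proof (rule ccontr)
    assume "\<not> 1 \<le> N (f n)"
    then have "modular \<phi> (P (e n)) < 1"
      using modular_finiteD(3)[OF finn[of n]] by (simp add: f_def[abs_def])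
    then obtain \<delta> where \<delta>: "0 < \<delta>" "modular \<phi> (\<lambda>t. (1 + \<delta>) * P (e n) t) \<le> 1"
      using gap[OF Pm[OF Be]] by blast
    then have "orlicz_norm M E N \<phi> (P (e n)) \<le> 1 / (1 + \<delta>)"
      by (intro orlicz_norm_le) (auto simp: mult.commute)
    also have "\<dots> < 1" using \<delta>(1) by simp
    finally show False using Ne by simp
  qed
  have fg: "AE t in M. 0 \<le> f n t \<and> f n t \<le> g t" for n
    using abs_le[of n] modular_finiteD(1)[OF fin1]
    unfolding f_def g_def
    by eventually_elim (auto intro!: enn2real_mono orlicz_mono[OF \<phi>])
  have disj: "AE t in M. f m t = 0 \<or> f n t = 0" if "m \<noteq> n" for m n
    using e_disj[OF that] unfolding f_def by eventually_elim (auto simp: orlicz_zero[OF \<phi>])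
  show ?thesis by (rule contains_linf_of_disjoint_sequence[OF fE fN gE gN fg disj])
qed

end

theorem theorem5p21:
  fixes M :: "'a measure" and E :: "('a \<Rightarrow> real) set" and N :: "('a \<Rightarrow> real) \<Rightarrow> real"
    and \<phi> :: "real \<Rightarrow> ennreal" and \<alpha> :: ereal
  assumes "complete_measure M" and "sigma_finite_measure M" and "emeasure M (space M) > 0"
    and "quasi_Banach_ideal_space M E N" and "Fatou_property M E N"
    and "orlicz_function \<phi>" and "orlicz_a \<phi> < orlicz_b \<phi>"
    and "is_index M E \<phi> \<alpha>" and "\<alpha> > 0"
    and "(\<not> Linfty M \<subseteq> E \<and> \<not> E \<subseteq> Linfty M \<and> Delta2_str \<phi>) \<or>
      (Linfty M \<subseteq> E \<and>
        (Delta2_str \<phi> \<or>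
          (Banach_ideal_space M E N \<and> Delta2_str_infinity \<phi> \<and>
            strict_mono_on {u. orlicz_a \<phi> < ereal u} \<phi>))) \<or>
      (E \<subseteq> Linfty M \<and> Delta2_str_zero \<phi> \<and>
        ennreal (1 / ideal_lower_const M E N) \<le> orlicz_at_b \<phi> \<and>
        strict_mono_on {0<..<orlicz_inverse \<phi> (1 / ideal_lower_const M E N)} \<phi>)"
    and "contains_order_isometric_linf M (orlicz_space M E N \<phi>) (orlicz_norm M E N \<phi>)"
  shows "contains_order_isometric_linf M E N"
proof -
  interpret quasi_Banach_ideal M E N by unfold_locales (rule assms(4))
  note \<phi> = assms(6)
  have "0 \<le> orlicz_a \<phi>"
    unfolding orlicz_a_def using orlicz_zero[OF \<phi>] by (intro Sup_upper) (auto simp: zero_ereal_def)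
  then have b: "0 < orlicz_b \<phi>" using assms(7) by (rule order.strict_trans1)
  have "\<exists>\<delta>>0. modular \<phi> (\<lambda>t. (1 + \<delta>) * y t) \<le> 1"
    if y: "y \<in> borel_measurable M" "modular \<phi> y < 1" for y
    using assms(10) modular_gap_Delta2_str[OF \<phi> _ y]
      modular_gap_Delta2_str_infinity[OF \<phi> _ _ _ y]
      modular_gap_Delta2_str_zero[OF \<phi> b _ ideal_lower_const_pos[OF _ assms(3)] _ y]
    by blast
  from contains_linf_of_modular_gap[OF assms(5) \<phi> this assms(11)] show ?thesis .
qed

end
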